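(* For the system of total differential equations (T) to have at least one $(s_1,s_2)$-nonautonomous $(n-k_1,n-k_2)$-cylindricality $\mathbb R$-differentiable last multiplier $\mu\colon(z,w)\mapsto\mu({}^sz,{}^kw)$ on $G'$ (of the form described in the context), it is necessary and sufficient that there exist vector functions ${}^{s_1}\psi({}^sz,{}^kw)$, ${}^{s_2}\psi({}^sz,{}^kw)$, ${}^\lambda\varphi({}^sz,{}^kw)$ satisfying the functional system (E) with $H_l(z,w)=-\operatorname{div}\mathfrak X_l(z,w)$, $l=1,\dots,2m$, and such that the Pfaffian differential equation $\omega=0$ has the integrating factor $\nu({}^sz,{}^kw)=1$ for all $(z,w)\in G'$, where $$\omega=\sum_{\theta=1}^{s_1}\psi^{(1)}_\theta dz_\theta+\sum_{g=1}^{s_2}\psi^{(2)}_gd\overline z_{j_g}+\sum_{\xi=1}^{k_1}\varphi^{(1)}_\xi dw_\xi+\sum_{\tau=1}^{k_2}\varphi^{(2)}_\tau d\overline w_{\zeta_\tau}.$$ In this case the last multiplier is given by $\mu\colon(z,w)\mapsto\exp\int\omega$ for all $(z,w)\in G'$.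
   Context: Setting. $G\subset\mathbb C^{m+n}$ is a domain with points $(z,w)$, $z=(z_1,\dots,z_m)$, $w=(w_1,\dots,w_n)$, and $G'\subset G$ is a subdomain. $\mathbb R$-differentiable means differentiable as a function of the real and imaginary parts of the variables (all higher derivatives that appear are assumed to exist); $\partial_{z_j},\partial_{\overline z_j},\partial_{w_\xi},\partial_{\overline w_\xi}$ are Wirtinger derivatives; bars over functions denote complex conjugation. System (T) is $$dw_\xi=\sum_{j=1}^m\bigl(X_{\xi j}(z,w)\,dz_j+X_{\xi,m+j}(z,w)\,d\overline z_j\bigr),\quad \xi=1,\dots,n,\tag{T}$$ with $\mathbb R$-differentiable $X_{\xi l}\colon G\to\mathbb C$. Put, for $j=1,\dots,m$, $\mathfrak X_j=\partial_{z_j}+\sum_{\xi=1}^n(X_{\xi j}\partial_{w_\xi}+\overline X_{\xi,m+j}\partial_{\overline w_\xi})$ and $\mathfrak X_{m+j}=\partial_{\overline z_j}+\sum_{\xi=1}^n(X_{\xi,m+j}\partial_{w_\xi}+\overline X_{\xi j}\partial_{\overline w_\xi})$; their divergences are $\operatorname{div}\mathfrak X_j=\sum_\xi(\partial_{w_\xi}X_{\xi j}+\partial_{\overline w_\xi}\overline X_{\xi,m+j})$ and $\operatorname{div}\mathfrak X_{m+j}=\sum_\xi(\partial_{w_\xi}X_{\xi,m+j}+\partial_{\overline w_\xi}\overline X_{\xi j})$. An $\mathbb R$-differentiable function $\mu\colon G'\to\mathbb C$ (not identically zero) is a last multiplier of (T) if $\mathfrak X_l\mu=-\mu\operatorname{div}\mathfrak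 X_l$ on $G'$, $l=1,\dots,2m$. Form of the functions. Fix integers $0\le s_1,s_2\le m$, $0\le k_1,k_2\le n$, a permutation $(j_1,\dots,j_m)$ of $(1,\dots,m)$ and a permutation $(\zeta_1,\dots,\zeta_n)$ of $(1,\dots,n)$. A function of the form $\mu({}^sz,{}^kw)$ is an $\mathbb R$-differentiable function on $G'$ that is antiholomorphic in $z_{s_1+1},\dots,z_m,w_{k_1+1},\dots,w_n$ and holomorphic in $z_{j_{s_2+1}},\dots,z_{j_m},w_{\zeta_{k_2+1}},\dots,w_{\zeta_n}$, i.e. $\partial_\chi\mu=0$ for every $\chi$ in the list $$\mathcal V=\{z_\alpha\ (\alpha>s_1),\ \overline z_{j_\beta}\ (\beta>s_2),\ w_\gamma\ (\gamma>k_1),\ \overline w_{\zeta_\delta}\ (\delta>k_2)\}.$$ A last multiplier of this form is called $(s_1,s_2)$-nonautonomous and $(n-k_1,n-k_2)$-cylindricality. Notation. $\lambda=k_1+k_2$; for $j=1,\dots,m$, $${}^\lambda X^j=(X_{1j},\dots,X_{k_1j},\overline X_{\zeta_1,m+j},\dots,\overline X_{\zeta_{k_2},m+j}),\quad {}^\lambda X^{m+j}=(X_{1,m+j},\dots,X_{k_1,m+j},\overline X_{\zeta_1j},\dots,\overline X_{\zeta_{k_2}j}).$$ The unknown vector functions, all of whose components have the form $\cdot({}^sz,{}^kw)$, are ${}^{s_1}\psi=(\psi^{(1)}_1,\dots,\psi^{(1)}_{s_1})$, ${}^{s_2}\psi=(\psi^{(2)}_1,\dots,\psi^{(2)}_{s_2})$,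 ${}^{k_1}\varphi=(\varphi^{(1)}_1,\dots,\varphi^{(1)}_{k_1})$, ${}^{k_2}\varphi=(\varphi^{(2)}_1,\dots,\varphi^{(2)}_{k_2})$, ${}^\lambda\varphi=({}^{k_1}\varphi,{}^{k_2}\varphi)$. With $a\cdot b=\sum a_ib_i$, system (E) on $G'$ is: for every $\chi\in\mathcal V$, $\psi^{(1)}_\theta+{}^\lambda\varphi\cdot{}^\lambda X^\theta=H_\theta$, ${}^\lambda\varphi\cdot\partial_\chi^p\,{}^\lambda X^\theta=\partial_\chi^pH_\theta$, $p=1,\dots,\lambda$, $\theta=1,\dots,s_1$; ${}^\lambda\varphi\cdot{}^\lambda X^\eta=H_\eta$, ${}^\lambda\varphi\cdot\partial_\chi^p\,{}^\lambda X^\eta=\partial_\chi^pH_\eta$, $p=1,\dots,\lambda-1$, $\eta=s_1+1,\dots,m$; $\psi^{(2)}_g+{}^\lambda\varphi\cdot{}^\lambda X^{m+j_g}=H_{m+j_g}$, ${}^\lambda\varphi\cdot\partial_\chi^p\,{}^\lambda X^{m+j_g}=\partial_\chi^pH_{m+j_g}$, $p=1,\dots,\lambda$, $g=1,\dots,s_2$; ${}^\lambda\varphi\cdot{}^\lambda X^{m+j_\nu}=H_{m+j_\nu}$, ${}^\lambda\varphi\cdot\partial_\chi^p\,{}^\lambda X^{m+j_\nu}=\partial_\chi^pH_{m+j_\nu}$, $p=1,\dots,\lambda-1$, $\nu=s_2+1,\dots,m$. The Pfaffian equation $\omega=0$ has the integrating factor $1$ if $\omega=dg$ for some function $g({}^sz,{}^kw)$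 on $G'$; $\int\omega$ denotes such a $g$.
   Formalization: The equivalence is stated for simply connected G' and last multipliers μ without zeros, since necessity fails otherwise; sufficiency and μ = exp∫ω are stated for every subdomain G'. The X are taken λ+1 times and μ twice R-differentiable. *)

theory Defs
  imports "HOL-Analysis.Analysis" "HOL-Combinatorics.Permutations"
begin

(* Points (z, w) of C^m x C^n, with m = CARD('m) and n = CARD('n). The order of the index types
   numbers the coordinates z_1, ..., z_m and w_1, ..., w_n. All indices below are natural
   numbers counted from 1, as is usual on paper. *)

type_synonym ('m, 'n) point = "(complex ^ 'm) \<times> (complex ^ 'n)"

definition idx :: "nat \<Rightarrow> 'i::{finite,linorder}" where
  "idx i = sorted_list_of_set (UNIV :: 'i set) ! (i - 1)"

lemma bij_betw_idx: "bij_betw (idx :: nat \<Rightarrow> 'i::{finite,linorder}) {1..CARD('i)} UNIV"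
proof -
  let ?xs = "sorted_list_of_set (UNIV :: 'i set)"
  have "bij_betw ((!) ?xs) {..<length ?xs} (set ?xs)"
    by (rule bij_betw_nth) auto
  then have A: "bij_betw ((!) ?xs) {..<CARD('i)} UNIV"
    by simp
  have B: "bij_betw (\<lambda>i::nat. i - 1) {1..CARD('i)} {..<CARD('i)}"
    by (rule bij_betw_byWitness[where f' = Suc]) auto
  show ?thesis
    using bij_betw_trans[OF B A] unfolding idx_def[abs_def] comp_def .
qed

definition domain_in :: "'a::topological_space set \<Rightarrow> bool" where
  "domain_in S \<longleftrightarrow> open S \<and> connected S \<and> S \<noteq> {}"

(* r-fold R-differentiability on the open set S. Derivatives are Frechet derivatives over the
   reals; no continuity of the last derivatives is required. *)
primrec R_differentiable_on ::
    "nat \<Rightarrow> 'a::real_normed_vector set \<Rightarrow> ('a \<Rightarrow> complex) \<Rightarrow> bool" where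
  "R_differentiable_on 0 S f = True"
| "R_differentiable_on (Suc r) S f =
    ((\<forall>p\<in>S. f differentiable (at p)) \<and>
     (\<forall>v. R_differentiable_on r S (\<lambda>p. frechet_derivative f (at p) v)))"

(* Symbols for the variables z_j, conj z_j, w_xi, conj w_xi. *)
datatype cvar = Z nat | Zbar nat | W nat | Wbar nat

definition zdir :: "nat \<Rightarrow> complex \<Rightarrow> ('m::{finite,linorder}, 'n::{finite,linorder}) point" where
  "zdir i c = (axis (idx i) c, 0)"

definition wdir :: "nat \<Rightarrow> complex \<Rightarrow> ('m::{finite,linorder}, 'n::{finite,linorder}) point" where
  "wdir i c = (0, axis (idx i) c)"

(* Wirtinger derivatives: (d/dx - i d/dy) / 2 and (d/dx + i d/dy) / 2. *)
fun wirtinger :: "cvar \<Rightarrow> (('m::{finite,linorder}, 'n::{finite,linorder}) point \<Rightarrow> complex)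
    \<Rightarrow> ('m, 'n) point \<Rightarrow> complex" where
  "wirtinger (Z i) f p =
    (frechet_derivative f (at p) (zdir i 1) - \<i> * frechet_derivative f (at p) (zdir i \<i>)) / 2"
| "wirtinger (Zbar i) f p =
    (frechet_derivative f (at p) (zdir i 1) + \<i> * frechet_derivative f (at p) (zdir i \<i>)) / 2"
| "wirtinger (W i) f p =
    (frechet_derivative f (at p) (wdir i 1) - \<i> * frechet_derivative f (at p) (wdir i \<i>)) / 2"
| "wirtinger (Wbar i) f p =
    (frechet_derivative f (at p) (wdir i 1) + \<i> * frechet_derivative f (at p) (wdir i \<i>)) / 2"

(* System (T) is given by its coefficients X xi l, 1 <= xi <= n, 1 <= l <= 2m. The operators and
   divergences for l <= m and for l > m are written uniformly: opp m exchanges j and m + j, and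
   tvar m l is z_l for l <= m and conj z_(l-m) for l > m. *)

definition opp :: "nat \<Rightarrow> nat \<Rightarrow> nat" where
  "opp m l = (if l \<le> m then m + l else l - m)"

definition tvar :: "nat \<Rightarrow> nat \<Rightarrow> cvar" where
  "tvar m l = (if l \<le> m then Z l else Zbar (l - m))"

definition frakX ::
    "(nat \<Rightarrow> nat \<Rightarrow> ('m::{finite,linorder}, 'n::{finite,linorder}) point \<Rightarrow> complex) \<Rightarrow> nat
     \<Rightarrow> (('m, 'n) point \<Rightarrow> complex) \<Rightarrow> ('m, 'n) point \<Rightarrow> complex" where
  "frakX X l f p = wirtinger (tvar CARD('m) l) f p +
    (\<Sum>\<xi>=1..CARD('n). X \<xi> l p * wirtinger (W \<xi>) f p
                     + cnj (X \<xi> (opp CARD('m) l) p) * wirtinger (Wbar \<xi>) f p)"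

definition divX ::
    "(nat \<Rightarrow> nat \<Rightarrow> ('m::{finite,linorder}, 'n::{finite,linorder}) point \<Rightarrow> complex) \<Rightarrow> nat
     \<Rightarrow> ('m, 'n) point \<Rightarrow> complex" where
  "divX X l p =
    (\<Sum>\<xi>=1..CARD('n). wirtinger (W \<xi>) (X \<xi> l) p
                     + wirtinger (Wbar \<xi>) (\<lambda>q. cnj (X \<xi> (opp CARD('m) l) q)) p)"

definition last_multiplier ::
    "(nat \<Rightarrow> nat \<Rightarrow> ('m::{finite,linorder}, 'n::{finite,linorder}) point \<Rightarrow> complex)
     \<Rightarrow> ('m, 'n) point set \<Rightarrow> (('m, 'n) point \<Rightarrow> complex) \<Rightarrow> bool" where
  "last_multiplier X G' \<mu> \<longleftrightarrow>
    R_differentiable_on 1 G' \<mu> \<and> (\<exists>p\<in>G'. \<mu> p \<noteq> 0) \<and>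
    (\<forall>l\<in>{1..2 * CARD('m)}. \<forall>p\<in>G'. frakX X l \<mu> p = - \<mu> p * divX X l p)"

definition missing_vars :: "nat \<Rightarrow> nat \<Rightarrow> nat \<Rightarrow> nat \<Rightarrow> nat \<Rightarrow> nat
    \<Rightarrow> (nat \<Rightarrow> nat) \<Rightarrow> (nat \<Rightarrow> nat) \<Rightarrow> cvar set" where
  "missing_vars m n s1 s2 k1 k2 j \<zeta> =
    {Z \<alpha> |\<alpha>. s1 < \<alpha> \<and> \<alpha> \<le> m} \<union> {Zbar (j \<beta>) |\<beta>. s2 < \<beta> \<and> \<beta> \<le> m} \<union>
    {W \<gamma> |\<gamma>. k1 < \<gamma> \<and> \<gamma> \<le> n} \<union> {Wbar (\<zeta> \<delta>) |\<delta>. k2 < \<delta> \<and> \<delta> \<le> n}"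

(* f has the form f(^s z, ^k w), where V is the set of missing variables, and is r times
   R-differentiable. *)
definition has_form :: "nat \<Rightarrow> cvar set \<Rightarrow> ('m::{finite,linorder}, 'n::{finite,linorder}) point set
    \<Rightarrow> (('m, 'n) point \<Rightarrow> complex) \<Rightarrow> bool" where
  "has_form r V G' f \<longleftrightarrow>
    R_differentiable_on r G' f \<and> (\<forall>\<kappa>\<in>V. \<forall>p\<in>G'. wirtinger \<kappa> f p = 0)"

(* The scalar product of ^lambda phi with D ^lambda X^l, where D is an operator on functions:
   either the identity or an iterated Wirtinger derivative. *)
definition phi_dot ::
    "(nat \<Rightarrow> nat \<Rightarrow> ('m::{finite,linorder}, 'n::{finite,linorder}) point \<Rightarrow> complex)
     \<Rightarrow> nat \<Rightarrow> nat \<Rightarrow> (nat \<Rightarrow> nat) \<Rightarrow> (nat \<Rightarrow> ('m, 'n) point \<Rightarrow> complex)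
     \<Rightarrow> (nat \<Rightarrow> ('m, 'n) point \<Rightarrow> complex)
     \<Rightarrow> ((('m, 'n) point \<Rightarrow> complex) \<Rightarrow> ('m, 'n) point \<Rightarrow> complex)
     \<Rightarrow> nat \<Rightarrow> ('m, 'n) point \<Rightarrow> complex" where
  "phi_dot X k1 k2 \<zeta> \<phi>1 \<phi>2 D l x =
    (\<Sum>\<xi>=1..k1. \<phi>1 \<xi> x * D (X \<xi> l) x) +
    (\<Sum>\<tau>=1..k2. \<phi>2 \<tau> x * D (\<lambda>y. cnj (X (\<zeta> \<tau>) (opp CARD('m) l) y)) x)"

(* System (E). The underived equations stand outside the quantifier over kappa, so that they
   remain in force when no variable is missing. *)
definition system_E ::
    "(nat \<Rightarrow> nat \<Rightarrow> ('m::{finite,linorder}, 'n::{finite,linorder}) point \<Rightarrow> complex)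
     \<Rightarrow> (nat \<Rightarrow> ('m, 'n) point \<Rightarrow> complex) \<Rightarrow> ('m, 'n) point set
     \<Rightarrow> nat \<Rightarrow> nat \<Rightarrow> nat \<Rightarrow> nat \<Rightarrow> (nat \<Rightarrow> nat) \<Rightarrow> (nat \<Rightarrow> nat)
     \<Rightarrow> (nat \<Rightarrow> ('m, 'n) point \<Rightarrow> complex) \<Rightarrow> (nat \<Rightarrow> ('m, 'n) point \<Rightarrow> complex)
     \<Rightarrow> (nat \<Rightarrow> ('m, 'n) point \<Rightarrow> complex) \<Rightarrow> (nat \<Rightarrow> ('m, 'n) point \<Rightarrow> complex) \<Rightarrow> bool" where
  "system_E X H G' s1 s2 k1 k2 j \<zeta> \<psi>1 \<psi>2 \<phi>1 \<phi>2 \<longleftrightarrow>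
    (let m = CARD('m); n = CARD('n); k = k1 + k2;
         V = missing_vars m n s1 s2 k1 k2 j \<zeta>;
         dot = phi_dot X k1 k2 \<zeta> \<phi>1 \<phi>2 in
     \<forall>x\<in>G'.
      (\<forall>\<theta>\<in>{1..s1}.
         \<psi>1 \<theta> x + dot (\<lambda>f. f) \<theta> x = H \<theta> x \<and>
         (\<forall>\<kappa>\<in>V. \<forall>p\<in>{1..k}. dot (wirtinger \<kappa> ^^ p) \<theta> x = (wirtinger \<kappa> ^^ p) (H \<theta>) x)) \<and>
      (\<forall>\<eta>\<in>{s1+1..m}.
         dot (\<lambda>f. f) \<eta> x = H \<eta> x \<and>
         (\<forall>\<kappa>\<in>V. \<forall>p\<in>{1..k-1}. dot (wirtinger \<kappa> ^^ p) \<eta> x = (wirtinger \<kappa> ^^ p) (H \<eta>) x)) \<and>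
      (\<forall>g\<in>{1..s2}.
         \<psi>2 g x + dot (\<lambda>f. f) (m + j g) x = H (m + j g) x \<and>
         (\<forall>\<kappa>\<in>V. \<forall>p\<in>{1..k}. dot (wirtinger \<kappa> ^^ p) (m + j g) x = (wirtinger \<kappa> ^^ p) (H (m + j g)) x)) \<and>
      (\<forall>\<nu>\<in>{s2+1..m}.
         dot (\<lambda>f. f) (m + j \<nu>) x = H (m + j \<nu>) x \<and>
         (\<forall>\<kappa>\<in>V. \<forall>p\<in>{1..k-1}. dot (wirtinger \<kappa> ^^ p) (m + j \<nu>) x = (wirtinger \<kappa> ^^ p) (H (m + j \<nu>)) x)))"

(* A differential 1-form is represented by its value at a point x on a tangent vector v;
   dz_i(v) and dw_i(v) are the corresponding components of v. *)
definition omega ::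
    "nat \<Rightarrow> nat \<Rightarrow> nat \<Rightarrow> nat \<Rightarrow> (nat \<Rightarrow> nat) \<Rightarrow> (nat \<Rightarrow> nat)
     \<Rightarrow> (nat \<Rightarrow> ('m::{finite,linorder}, 'n::{finite,linorder}) point \<Rightarrow> complex)
     \<Rightarrow> (nat \<Rightarrow> ('m, 'n) point \<Rightarrow> complex) \<Rightarrow> (nat \<Rightarrow> ('m, 'n) point \<Rightarrow> complex)
     \<Rightarrow> (nat \<Rightarrow> ('m, 'n) point \<Rightarrow> complex) \<Rightarrow> ('m, 'n) point \<Rightarrow> ('m, 'n) point \<Rightarrow> complex" where
  "omega s1 s2 k1 k2 j \<zeta> \<psi>1 \<psi>2 \<phi>1 \<phi>2 x v =
    (\<Sum>\<theta>=1..s1. \<psi>1 \<theta> x * (fst v $ idx \<theta>)) +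
    (\<Sum>g=1..s2. \<psi>2 g x * cnj (fst v $ idx (j g))) +
    (\<Sum>\<xi>=1..k1. \<phi>1 \<xi> x * (snd v $ idx \<xi>)) +
    (\<Sum>\<tau>=1..k2. \<phi>2 \<tau> x * cnj (snd v $ idx (\<zeta> \<tau>)))"

(* g is an integral of the 1-form om: om = dg on G' with g of the form g(^s z, ^k w). *)
definition form_integral :: "cvar set \<Rightarrow> ('m::{finite,linorder}, 'n::{finite,linorder}) point set
    \<Rightarrow> (('m, 'n) point \<Rightarrow> ('m, 'n) point \<Rightarrow> complex) \<Rightarrow> (('m, 'n) point \<Rightarrow> complex) \<Rightarrow> bool" where
  "form_integral V G' om g \<longleftrightarrow>
    has_form 1 V G' g \<and> (\<forall>x\<in>G'. (g has_derivative om x) (at x))"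

definition has_integrating_factor_1 ::
    "cvar set \<Rightarrow> ('m::{finite,linorder}, 'n::{finite,linorder}) point set
     \<Rightarrow> (('m, 'n) point \<Rightarrow> ('m, 'n) point \<Rightarrow> complex) \<Rightarrow> bool" where
  "has_integrating_factor_1 V G' om \<longleftrightarrow> (\<exists>g. form_integral V G' om g)"

(* The vector functions psi, phi are of the required form and satisfy (E) with H_l = - div X_l. *)
definition E_solution ::
    "(nat \<Rightarrow> nat \<Rightarrow> ('m::{finite,linorder}, 'n::{finite,linorder}) point \<Rightarrow> complex)
     \<Rightarrow> ('m, 'n) point set \<Rightarrow> nat \<Rightarrow> nat \<Rightarrow> nat \<Rightarrow> nat \<Rightarrow> (nat \<Rightarrow> nat) \<Rightarrow> (nat \<Rightarrow> nat)
     \<Rightarrow> (nat \<Rightarrow> ('m, 'n) point \<Rightarrow> complex) \<Rightarrow> (nat \<Rightarrow> ('m, 'n) point \<Rightarrow> complex)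
     \<Rightarrow> (nat \<Rightarrow> ('m, 'n) point \<Rightarrow> complex) \<Rightarrow> (nat \<Rightarrow> ('m, 'n) point \<Rightarrow> complex) \<Rightarrow> bool" where
  "E_solution X G' s1 s2 k1 k2 j \<zeta> \<psi>1 \<psi>2 \<phi>1 \<phi>2 \<longleftrightarrow>
    (let V = missing_vars CARD('m) CARD('n) s1 s2 k1 k2 j \<zeta> in
     (\<forall>\<theta>\<in>{1..s1}. has_form 1 V G' (\<psi>1 \<theta>)) \<and>
     (\<forall>g\<in>{1..s2}. has_form 1 V G' (\<psi>2 g)) \<and>
     (\<forall>\<xi>\<in>{1..k1}. has_form 1 V G' (\<phi>1 \<xi>)) \<and>
     (\<forall>\<tau>\<in>{1..k2}. has_form 1 V G' (\<phi>2 \<tau>)) \<and>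
     system_E X (\<lambda>l x. - divX X l x) G' s1 s2 k1 k2 j \<zeta> \<psi>1 \<psi>2 \<phi>1 \<phi>2)"

(* A last multiplier of the form mu(^s z, ^k w). It is required to be twice R-differentiable:
   the functions psi, phi belonging to mu are the first derivatives of log mu, and they are
   themselves to be R-differentiable. *)
definition form_last_multiplier ::
    "(nat \<Rightarrow> nat \<Rightarrow> ('m::{finite,linorder}, 'n::{finite,linorder}) point \<Rightarrow> complex)
     \<Rightarrow> ('m, 'n) point set \<Rightarrow> nat \<Rightarrow> nat \<Rightarrow> nat \<Rightarrow> nat \<Rightarrow> (nat \<Rightarrow> nat) \<Rightarrow> (nat \<Rightarrow> nat)
     \<Rightarrow> (('m, 'n) point \<Rightarrow> complex) \<Rightarrow> bool" where
  "form_last_multiplier X G' s1 s2 k1 k2 j \<zeta> \<mu> \<longleftrightarrow>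
    last_multiplier X G' \<mu> \<and>
    has_form 2 (missing_vars CARD('m) CARD('n) s1 s2 k1 k2 j \<zeta>) G' \<mu>"

end

theory Submission
  imports Defs
begin

text \<open>
Everything rests on the substitution \<open>\<mu> = exp g\<close>. As \<open>frakX X l\<close> is a derivation,
\<open>frakX X l (exp g) = exp g * frakX X l g\<close>, so \<open>\<mu>\<close> satisfies the multiplier equations exactly when
\<open>frakX X l g = - divX X l\<close> for all \<open>l\<close>: the multiplier equation becomes a condition
on the differential of \<open>g\<close> alone. If \<open>g\<close> does not involve the variables in \<open>V\<close>, the only coefficients of
\<open>dg\<close> left are those at \<open>dz\<^sub>\<theta>\<close>, at the conjugate differentials with indices \<open>j g\<close>, and likewise for
\<open>w\<close>. Calling them \<open>\<psi>\<close> and \<open>\<phi>\<close>, one has \<open>dg = \<omega>\<close> (\<open>frechet_derivative_eq_omega\<close>), and the linear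
equations for \<open>g\<close> are precisely the underived equations of the functional system
(\<open>frakX_eq_dot\<close>).

The derived equations are consequences of the underived ones. The functions \<open>\<psi>\<close> and \<open>\<phi>\<close> do not
involve the variables in \<open>V\<close> either, so that differentiating with respect to such a variable
touches only the coefficients \<open>X\<close> and the right-hand side (\<open>derived_equations\<close>). That \<open>\<psi>\<close> and \<open>\<phi>\<close>
inherit the form of \<open>g\<close> is due to the commutation of Wirtinger derivatives, which for
twice differentiable functions comes from the pointwise symmetry of the second derivative
(\<open>second_derivative_symmetric\<close>).

Two directions remain. Given a solution and an integral \<open>g\<close> of \<open>\<omega>\<close>, the function \<open>exp g\<close> is a last
multiplier; it has two derivatives because the coefficients of \<open>\<omega>\<close> have one. Given a multiplier
without zeros on a simply connected domain, a logarithm \<open>g\<close> exists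
(\<open>exists_logarithm_of_form\<close>), and its differential supplies the solution.
\<close>

section \<open>Iterated real differentiability\<close>

text \<open>The equation covers non-differentiable functions as well, since both sides
choose from the same set of derivatives. Iterated Wirtinger derivatives can therefore
be rewritten on an open set without checking differentiability first.\<close>

lemma frechet_derivative_cong_open:
  assumes "open S" "p \<in> S" "\<And>q. q \<in> S \<Longrightarrow> f q = g q"
  shows "frechet_derivative f (at p) = frechet_derivative g (at p)"
proof -
  have "(f has_derivative D) (at p) \<longleftrightarrow> (g has_derivative D) (at p)" for D
    using assms by (metis has_derivative_transform_within_open)
  then show ?thesis
    by (simp add: frechet_derivative_def)
qed

lemma differentiable_cong_open:
  assumes "open S" "p \<in> S" "\<And>q. q \<in> S \<Longrightarrow> f q = g q" "f differentiable (at p)"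
  shows "g differentiable (at p)"
  using assms by (metis differentiable_def has_derivative_transform_within_open)

lemma R_differentiable_on_cong:
  assumes "open S" "R_differentiable_on r S f" "\<And>q. q \<in> S \<Longrightarrow> f q = g q"
  shows "R_differentiable_on r S g"
  using assms(2,3)
proof (induction r arbitrary: f g)
  case (Suc r)
  have eq: "frechet_derivative f (at p) = frechet_derivative g (at p)" if "p \<in> S" for p
    by (rule frechet_derivative_cong_open[OF assms(1) that Suc.prems(2)])
  have "R_differentiable_on r S (\<lambda>p. frechet_derivative g (at p) v)" for v
    by (rule Suc.IH[of "\<lambda>p. frechet_derivative f (at p) v"]) (use Suc.prems(1) eq in simp_all)
  moreover have "g differentiable (at p)" if "p \<in> S" for p
    by (rule differentiable_cong_open[OF assms(1) that Suc.prems(2)]) (use Suc.prems(1) that in simp_all)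
  ultimately show ?case by simp
qed simp

lemma R_differentiable_on_subset:
  "R_differentiable_on r S f \<Longrightarrow> T \<subseteq> S \<Longrightarrow> R_differentiable_on r T f"
  by (induction r arbitrary: f) auto

lemma R_differentiable_on_Suc_imp:
  "R_differentiable_on (Suc r) S f \<Longrightarrow> R_differentiable_on r S f"
proof (induction r arbitrary: f)
  case (Suc r)
  show ?case
    using Suc.prems Suc.IH[of "\<lambda>p. frechet_derivative f (at p) v" for v]
    by (subst R_differentiable_on.simps) auto
qed simp

lemma R_differentiable_on_le:
  assumes "R_differentiable_on r S f" "q \<le> r"
  shows "R_differentiable_on q S f"
  using assms(2,1) by (induction rule: inc_induct) (simp_all add: R_differentiable_on_Suc_imp del: R_differentiable_on.simps)

lemma R_differentiable_on_bounded_linear: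
  assumes "open S" "bounded_linear L" "R_differentiable_on r S f"
  shows "R_differentiable_on r S (\<lambda>x. L (f x))"
  using assms(3)
proof (induction r arbitrary: f)
  case (Suc r)
  have D: "((\<lambda>x. L (f x)) has_derivative (\<lambda>v. L (frechet_derivative f (at p) v))) (at p)"
    if "p \<in> S" for p
    using Suc.prems that
    by (intro bounded_linear.has_derivative[OF assms(2)]) (auto simp: frechet_derivative_works)
  have "R_differentiable_on r S (\<lambda>p. frechet_derivative (\<lambda>x. L (f x)) (at p) v)" for v
  proof (rule R_differentiable_on_cong[OF assms(1)])
    show "R_differentiable_on r S (\<lambda>p. L (frechet_derivative f (at p) v))"
      using Suc by simp
    show "L (frechet_derivative f (at q) v) = frechet_derivative (\<lambda>x. L (f x)) (at q) v"
      if "q \<in> S" for q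
      using frechet_derivative_at[OF D[OF that]] by metis
  qed
  moreover have "(\<lambda>x. L (f x)) differentiable (at p)" if "p \<in> S" for p
    using D[OF that] by (rule differentiableI)
  ultimately show ?case by simp
qed simp

lemma R_differentiable_on_const: "R_differentiable_on r S (\<lambda>x. c)"
  by (induction r arbitrary: c) simp_all

lemma R_differentiable_on_add:
  assumes "open S" "R_differentiable_on r S f" "R_differentiable_on r S g"
  shows "R_differentiable_on r S (\<lambda>x. f x + g x)"
  using assms(2,3)
proof (induction r arbitrary: f g)
  case (Suc r)
  have D: "((\<lambda>x. f x + g x) has_derivative
      (\<lambda>v. frechet_derivative f (at p) v + frechet_derivative g (at p) v)) (at p)"
    if "p \<in> S" for p
    using Suc.prems that
    by (intro has_derivative_add) (auto simp: frechet_derivative_works)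
  have "R_differentiable_on r S (\<lambda>p. frechet_derivative (\<lambda>x. f x + g x) (at p) v)" for v
  proof (rule R_differentiable_on_cong[OF assms(1)])
    show "R_differentiable_on r S
        (\<lambda>p. frechet_derivative f (at p) v + frechet_derivative g (at p) v)"
      using Suc by simp
    show "frechet_derivative f (at q) v + frechet_derivative g (at q) v =
        frechet_derivative (\<lambda>x. f x + g x) (at q) v" if "q \<in> S" for q
      using frechet_derivative_at[OF D[OF that]] by metis
  qed
  moreover have "(\<lambda>x. f x + g x) differentiable (at p)" if "p \<in> S" for p
    using D[OF that] by (rule differentiableI)
  ultimately show ?case by simp
qed simp

lemma R_differentiable_on_sum:
  assumes "open S" "\<And>i. i \<in> I \<Longrightarrow> R_differentiable_on r S (f i)"
  shows "R_differentiable_on r S (\<lambda>x. \<Sum>i\<in>I. f i x)"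
  using assms(2)
proof (induction I rule: infinite_finite_induct)
  case (insert i I)
  then show ?case
    using R_differentiable_on_add[OF assms(1), of r "f i" "\<lambda>x. \<Sum>i\<in>I. f i x"] by simp
qed (simp_all add: R_differentiable_on_const)

lemma R_differentiable_on_1:
  "R_differentiable_on 1 S f \<longleftrightarrow> (\<forall>p\<in>S. f differentiable (at p))"
  by (simp only: One_nat_def) simp

lemma R_differentiable_on_2:
  "R_differentiable_on 2 S f \<longleftrightarrow> (\<forall>p\<in>S. f differentiable (at p)) \<and>
     (\<forall>v. \<forall>p\<in>S. (\<lambda>q. frechet_derivative f (at q) v) differentiable (at p))"
  by (simp only: numeral_2_eq_2) simp

lemma R_differentiable_on_SucD:
  "R_differentiable_on (Suc r) S f \<Longrightarrow> R_differentiable_on r S (\<lambda>p. frechet_derivative f (at p) v)"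
  by simp

lemma R_differentiable_on_2D:
  assumes "R_differentiable_on 2 S f" "p \<in> S"
  shows "f differentiable (at p)" "(\<lambda>q. frechet_derivative f (at q) v) differentiable (at p)"
  using assms by (auto simp: R_differentiable_on_2)

section \<open>Symmetry of the second derivative\<close>

text \<open>The second difference in the directions \<open>u\<close>, \<open>v\<close> is the increment over \<open>[0, t]\<close> of
\<open>s \<mapsto> f (p + s u + t v) - f (p + s u)\<close>. By the mean value theorem it is controlled by the
derivative of this function at an intermediate \<open>s\<close>, which is \<open>f' (p + s u + t v) u - f' (p + s u) u\<close>.
Differentiability of \<open>f' \<cdot> u\<close> at the single point \<open>p\<close> makes this difference \<open>t A v + o(t)\<close>, uniformly
in \<open>s\<close>, and the argument involves second derivatives at \<open>p\<close> alone.\<close>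

lemma second_difference_quotient_tendsto:
  fixes f :: "'a::real_normed_vector \<Rightarrow> 'b::real_inner"
  assumes S: "open S" "p \<in> S"
    and f: "\<And>q. q \<in> S \<Longrightarrow> (f has_derivative f' q) (at q)"
    and A: "((\<lambda>q. f' q u) has_derivative A) (at p)"
  shows "((\<lambda>t. (1 / t\<^sup>2) *\<^sub>R (f (p + t *\<^sub>R u + t *\<^sub>R v) - f (p + t *\<^sub>R u) - f (p + t *\<^sub>R v) + f p))
           \<longlongrightarrow> A v) (at_right 0)"
proof (rule tendstoI)
  fix e :: real assume "e > 0"
  define C where "C = norm u + norm v + 1"
  have C: "C > 0" "C \<ge> 1" by (auto simp: C_def add_nonneg_pos)
  \<comment> \<open>Two remainders, each at most \<open>e' t C\<close>, add up to half of the permitted error.\<close>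
  define e' where "e' = e / (4 * C)"
  have "e' > 0" using C \<open>e > 0\<close> by (simp add: e'_def)
  interpret A: bounded_linear A using A by (rule has_derivative_bounded_linear)
  obtain d1 where d1: "d1 > 0"
    "\<And>y. norm (y - p) < d1 \<Longrightarrow> norm (f' y u - f' p u - A (y - p)) \<le> e' * norm (y - p)"
    using A \<open>e' > 0\<close> unfolding has_derivative_at_alt by (elim conjE allE[of _ e']) auto
  obtain d2 where d2: "d2 > 0" "ball p d2 \<subseteq> S"
    using S by (meson open_contains_ball)
  define d where "d = min d1 d2 / C"
  have "d > 0" using C d1 d2 by (simp add: d_def)
  have small: "norm (a *\<^sub>R u + b *\<^sub>R v) \<le> t * C" "t * C < d1" "t * C < d2"
    if "0 \<le> a" "a \<le> t" "0 \<le> b" "b \<le> t" "0 < t" "t < d" for a b t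
  proof -
    have "norm (a *\<^sub>R u + b *\<^sub>R v) \<le> a * norm u + b * norm v"
      using norm_triangle_ineq[of "a *\<^sub>R u" "b *\<^sub>R v"] that by simp
    also have "\<dots> \<le> t * norm u + t * norm v"
      using that by (intro add_mono mult_right_mono) auto
    also have "\<dots> \<le> t * C" using that by (simp add: C_def algebra_simps)
    finally show "norm (a *\<^sub>R u + b *\<^sub>R v) \<le> t * C" .
    have "t * C < min d1 d2"
      using that(6) C by (simp add: d_def pos_less_divide_eq)
    then show "t * C < d1" "t * C < d2" by auto
  qed
  have main: "dist ((1 / t\<^sup>2) *\<^sub>R
        (f (p + t *\<^sub>R u + t *\<^sub>R v) - f (p + t *\<^sub>R u) - f (p + t *\<^sub>R v) + f p)) (A v) < e"
    if t: "0 < t" "t < d" for t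
  proof -
    \<comment> \<open>The linear correction removes the expected value of the increment, so that the
      vector-valued mean value inequality yields an error estimate.\<close>
    let ?\<phi> = "\<lambda>s. f (p + s *\<^sub>R u + t *\<^sub>R v) - f (p + s *\<^sub>R u) - (s * t) *\<^sub>R A v"
    have in_S: "p + s *\<^sub>R u + t *\<^sub>R v \<in> S" "p + s *\<^sub>R u \<in> S" if "0 \<le> s" "s \<le> t" for s
    proof -
      have "dist (p + s *\<^sub>R u + t *\<^sub>R v) p < d2" "dist (p + s *\<^sub>R u) p < d2"
        using small[of s t t] small[of s t 0] that t by (simp_all add: dist_norm add.assoc)
      then show "p + s *\<^sub>R u + t *\<^sub>R v \<in> S" "p + s *\<^sub>R u \<in> S" using d2 by (auto simp: mem_ball dist_commute)
    qed
    have der: "(?\<phi> has_derivative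
        (\<lambda>h. f' (p + s *\<^sub>R u + t *\<^sub>R v) (h *\<^sub>R u) - f' (p + s *\<^sub>R u) (h *\<^sub>R u) - (h * t) *\<^sub>R A v)) (at s)"
      if "0 \<le> s" "s \<le> t" for s
    proof -
      have 1: "((\<lambda>s. f (p + s *\<^sub>R u + t *\<^sub>R v)) has_derivative
          (\<lambda>h. f' (p + s *\<^sub>R u + t *\<^sub>R v) (h *\<^sub>R u))) (at s)"
        by (rule has_derivative_compose[where f = "\<lambda>s. p + s *\<^sub>R u + t *\<^sub>R v" and g = f])
           (auto intro!: derivative_eq_intros f in_S that)
      have 2: "((\<lambda>s. f (p + s *\<^sub>R u)) has_derivative
          (\<lambda>h. f' (p + s *\<^sub>R u) (h *\<^sub>R u))) (at s)"
        by (rule has_derivative_compose[where f = "\<lambda>s. p + s *\<^sub>R u" and g = f])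
           (auto intro!: derivative_eq_intros f in_S that)
      show ?thesis
        by (intro has_derivative_diff 1 2) (auto intro!: derivative_eq_intros)
    qed
    have "continuous_on {0..t} ?\<phi>"
      using der by (meson atLeastAtMost_iff continuous_at_imp_continuous_on has_derivative_continuous)
    then obtain s where s: "s \<in> {0<..<t}" and
      le: "norm (?\<phi> t - ?\<phi> 0) \<le> norm (f' (p + s *\<^sub>R u + t *\<^sub>R v) ((t - 0) *\<^sub>R u)
             - f' (p + s *\<^sub>R u) ((t - 0) *\<^sub>R u) - ((t - 0) * t) *\<^sub>R A v)"
      using mvt_general[OF t(1), of ?\<phi>, OF _ der] by force
    have lin: "f' q (t *\<^sub>R u) = t *\<^sub>R f' q u" if "q \<in> S" for q
      using has_derivative_bounded_linear[OF f[OF that]]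
      by (simp add: bounded_linear.linear linear_scale)
    let ?R = "\<lambda>y. f' y u - f' p u - A (y - p)"
    have R: "norm (?R (p + s *\<^sub>R u + t *\<^sub>R v)) \<le> e' * (t * C)"
            "norm (?R (p + s *\<^sub>R u)) \<le> e' * (t * C)"
      using d1(2)[of "p + s *\<^sub>R u + t *\<^sub>R v"] d1(2)[of "p + s *\<^sub>R u"]
        small[of s t t] small[of s t 0] s t \<open>e' > 0\<close>
      by (auto simp: add.assoc elim!: order_trans intro!: mult_left_mono)
    have "f' (p + s *\<^sub>R u + t *\<^sub>R v) (t *\<^sub>R u) - f' (p + s *\<^sub>R u) (t *\<^sub>R u) - (t * t) *\<^sub>R A v
        = t *\<^sub>R (?R (p + s *\<^sub>R u + t *\<^sub>R v) - ?R (p + s *\<^sub>R u))"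
      using in_S[of s] s by (simp add: lin A.add A.scaleR A.diff algebra_simps)
    then have "norm (?\<phi> t - ?\<phi> 0) \<le> t * norm (?R (p + s *\<^sub>R u + t *\<^sub>R v) - ?R (p + s *\<^sub>R u))"
      using le t by simp
    also have "\<dots> \<le> t * (e' * (t * C) + e' * (t * C))"
      by (intro mult_left_mono order_trans[OF norm_triangle_ineq4 add_mono] R) (use t in simp)
    also have "\<dots> = t\<^sup>2 * (e / 2)"
      using C by (simp add: e'_def power2_eq_square field_simps)
    finally have *: "norm (?\<phi> t - ?\<phi> 0) \<le> t\<^sup>2 * (e / 2)" .
    let ?\<Delta> = "f (p + t *\<^sub>R u + t *\<^sub>R v) - f (p + t *\<^sub>R u) - f (p + t *\<^sub>R v) + f p"
    have "(1 / t\<^sup>2) *\<^sub>R ?\<Delta> - A v = (1 / t\<^sup>2) *\<^sub>R (?\<phi> t - ?\<phi> 0)"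
      using t by (simp add: algebra_simps power2_eq_square)
    then have "norm ((1 / t\<^sup>2) *\<^sub>R ?\<Delta> - A v) = (1 / t\<^sup>2) * norm (?\<phi> t - ?\<phi> 0)"
      by simp
    also have "\<dots> \<le> (1 / t\<^sup>2) * (t\<^sup>2 * (e / 2))"
      using * by (intro mult_left_mono) auto
    also have "\<dots> < e" using t \<open>e > 0\<close> by simp
    finally show ?thesis by (simp add: dist_norm)
  qed
  then show "\<forall>\<^sub>F t in at_right 0. dist ((1 / t\<^sup>2) *\<^sub>R
        (f (p + t *\<^sub>R u + t *\<^sub>R v) - f (p + t *\<^sub>R u) - f (p + t *\<^sub>R v) + f p)) (A v) < e"
    using \<open>d > 0\<close> unfolding eventually_at_right_field by auto
qed

text \<open>The second difference is symmetric in \<open>u\<close> and \<open>v\<close>, and its normalised limit is \<open>A v\<close> as well as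
\<open>B u\<close>.\<close>

theorem second_derivative_symmetric:
  fixes f :: "'a::real_normed_vector \<Rightarrow> 'b::real_inner"
  assumes S: "open S" "p \<in> S"
    and f: "\<And>q. q \<in> S \<Longrightarrow> (f has_derivative f' q) (at q)"
    and A: "((\<lambda>q. f' q u) has_derivative A) (at p)"
    and B: "((\<lambda>q. f' q v) has_derivative B) (at p)"
  shows "A v = B u"
proof -
  have "((\<lambda>t. (1 / t\<^sup>2) *\<^sub>R (f (p + t *\<^sub>R u + t *\<^sub>R v) - f (p + t *\<^sub>R u) - f (p + t *\<^sub>R v) + f p))
           \<longlongrightarrow> B u) (at_right 0)"
    using second_difference_quotient_tendsto[OF S f B, of u] by (simp add: algebra_simps)
  then show ?thesis
    using second_difference_quotient_tendsto[OF S f A, of v] tendsto_unique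
      trivial_limit_at_right_real by blast
qed

section \<open>Wirtinger derivatives as coefficients of real-linear forms\<close>

fun var_dir :: "cvar \<Rightarrow> complex \<Rightarrow> ('m::{finite,linorder}, 'n::{finite,linorder}) point" where
  "var_dir (Z i) = zdir i"
| "var_dir (Zbar i) = zdir i"
| "var_dir (W i) = wdir i"
| "var_dir (Wbar i) = wdir i"

fun conj_sign :: "cvar \<Rightarrow> complex" where
  "conj_sign (Z i) = - 1"
| "conj_sign (Zbar i) = 1"
| "conj_sign (W i) = - 1"
| "conj_sign (Wbar i) = 1"

text \<open>A Wirtinger derivative depends only on the Frechet derivative, a real-linear form \<open>L\<close>. The
coefficient of \<open>L\<close> at the differential of the variable \<open>\<kappa>\<close> is \<open>form_coeff \<kappa> L\<close>. Working with
coefficients of forms turns the four clauses of the definition into one and applies to \<open>omega\<close>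
and to derivatives alike.\<close>

definition form_coeff :: "cvar \<Rightarrow> (('m::{finite,linorder}, 'n::{finite,linorder}) point \<Rightarrow> complex) \<Rightarrow> complex" where
  "form_coeff \<kappa> L = (L (var_dir \<kappa> 1) + conj_sign \<kappa> * \<i> * L (var_dir \<kappa> \<i>)) / 2"

lemma wirtinger_conv_form_coeff: "wirtinger \<kappa> f p = form_coeff \<kappa> (frechet_derivative f (at p))"
  by (cases \<kappa>) (simp_all add: form_coeff_def)

declare wirtinger.simps [simp del]

lemma wirtinger_eqI: "(f has_derivative D) (at p) \<Longrightarrow> wirtinger \<kappa> f p = form_coeff \<kappa> D"
  by (simp add: wirtinger_conv_form_coeff flip: frechet_derivative_at)

lemma form_coeff_add: "form_coeff \<kappa> (\<lambda>v. L v + M v) = form_coeff \<kappa> L + form_coeff \<kappa> M"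
  and form_coeff_scale: "form_coeff \<kappa> (\<lambda>v. c * L v) = c * form_coeff \<kappa> L"
  and form_coeff_sum: "form_coeff \<kappa> (\<lambda>v. \<Sum>i\<in>I. N i v) = (\<Sum>i\<in>I. form_coeff \<kappa> (N i))"
  by (simp_all add: form_coeff_def algebra_simps add_divide_distrib sum_distrib_left
      sum.distrib sum_divide_distrib)

lemma wirtinger_cong:
  assumes "open S" "p \<in> S" "\<And>q. q \<in> S \<Longrightarrow> f q = g q"
  shows "wirtinger \<kappa> f p = wirtinger \<kappa> g p"
  using frechet_derivative_cong_open[OF assms] by (simp add: wirtinger_conv_form_coeff)

lemma wirtinger_zero [simp]: "wirtinger \<kappa> (\<lambda>p. 0) p = 0"
  by (simp add: wirtinger_conv_form_coeff form_coeff_def)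

lemma wirtinger_add:
  assumes "f differentiable (at p)" "g differentiable (at p)"
  shows "wirtinger \<kappa> (\<lambda>q. f q + g q) p = wirtinger \<kappa> f p + wirtinger \<kappa> g p"
  using wirtinger_eqI[OF has_derivative_add[OF assms[unfolded frechet_derivative_works]]]
  by (simp add: wirtinger_conv_form_coeff form_coeff_add)

lemma wirtinger_mult:
  assumes "f differentiable (at p)" "g differentiable (at p)"
  shows "wirtinger \<kappa> (\<lambda>q. f q * g q) p = f p * wirtinger \<kappa> g p + g p * wirtinger \<kappa> f p"
proof -
  have "((\<lambda>q. f q * g q) has_derivative
      (\<lambda>v. f p * frechet_derivative g (at p) v + g p * frechet_derivative f (at p) v)) (at p)"
    using has_derivative_mult[OF assms[unfolded frechet_derivative_works]]
    by (simp add: mult.commute)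
  from wirtinger_eqI[OF this] show ?thesis
    by (simp add: wirtinger_conv_form_coeff form_coeff_add form_coeff_scale)
qed

lemma wirtinger_sum:
  assumes "\<And>i. i \<in> I \<Longrightarrow> f i differentiable (at p)"
  shows "wirtinger \<kappa> (\<lambda>q. \<Sum>i\<in>I. f i q) p = (\<Sum>i\<in>I. wirtinger \<kappa> (f i) p)"
  using wirtinger_eqI[OF has_derivative_sum[of I f "\<lambda>i. frechet_derivative (f i) (at p)" "at p"]] assms
  by (simp add: wirtinger_conv_form_coeff form_coeff_sum frechet_derivative_works)

lemma has_derivative_exp_comp:
  fixes g :: "'a::real_normed_vector \<Rightarrow> complex"
  assumes "(g has_derivative D) (at p)"
  shows "((\<lambda>x. exp (g x)) has_derivative (\<lambda>v. exp (g p) * D v)) (at p)"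
  using has_derivative_compose[OF assms, of exp "\<lambda>h. exp (g p) * h"] DERIV_exp[of "g p"]
  by (simp add: has_field_derivative_def)

lemma wirtinger_exp:
  assumes "g differentiable (at p)"
  shows "wirtinger \<kappa> (\<lambda>q. exp (g q)) p = exp (g p) * wirtinger \<kappa> g p"
  using wirtinger_eqI[OF has_derivative_exp_comp[OF assms[unfolded frechet_derivative_works]]]
  by (simp add: wirtinger_conv_form_coeff form_coeff_scale)

lemma R_differentiable_on_wirtinger:
  assumes "open S" "R_differentiable_on (Suc r) S f"
  shows "R_differentiable_on r S (wirtinger \<kappa> f)"
proof -
  let ?D = "\<lambda>v p. frechet_derivative f (at p) v"
  have D: "R_differentiable_on r S (?D v)" for v
    using assms(2) by (rule R_differentiable_on_SucD)
  have "R_differentiable_on r S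
      (\<lambda>p. ?D (var_dir \<kappa> 1) p / 2 + conj_sign \<kappa> * \<i> / 2 * ?D (var_dir \<kappa> \<i>) p)"
    by (intro R_differentiable_on_add[OF assms(1)] D
        R_differentiable_on_bounded_linear[OF assms(1) bounded_linear_mult_right]
        R_differentiable_on_bounded_linear[OF assms(1) bounded_linear_divide])
  then show ?thesis
    by (rule R_differentiable_on_cong[OF assms(1)])
       (simp add: wirtinger_conv_form_coeff form_coeff_def add_divide_distrib)
qed

lemma R_differentiable_on_wirtinger_funpow:
  assumes "open S" "R_differentiable_on (r + p) S f"
  shows "R_differentiable_on r S ((wirtinger \<kappa> ^^ p) f)"
  using assms(2)
  by (induction p arbitrary: r)
     (simp_all add: R_differentiable_on_wirtinger[OF assms(1)] del: R_differentiable_on.simps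
       flip: add_Suc)

text \<open>Wirtinger derivatives are constant complex combinations of directional derivatives, which
commute by the symmetry of the second derivative.\<close>

lemma wirtinger_commute:
  assumes "open S" "p \<in> S" "R_differentiable_on 2 S f"
  shows "wirtinger \<kappa> (wirtinger \<kappa>' f) p = wirtinger \<kappa>' (wirtinger \<kappa> f) p"
proof -
  let ?D = "\<lambda>v q. frechet_derivative f (at q) v"
  define E where "E v = frechet_derivative (?D v) (at p)" for v
  have f: "(f has_derivative frechet_derivative f (at q)) (at q)" if "q \<in> S" for q
    using R_differentiable_on_2D(1)[OF assms(3) that] by (simp add: frechet_derivative_works)
  have E: "(?D v has_derivative E v) (at p)" for v
    using R_differentiable_on_2D(2)[OF assms(3,2)] by (simp add: E_def flip: frechet_derivative_works)
  have sym: "E u v = E v u" for u v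
    using second_derivative_symmetric[OF assms(1,2) f E E] .
  have "(wirtinger \<kappa>' f has_derivative
      (\<lambda>v. (E (var_dir \<kappa>' 1) v + conj_sign \<kappa>' * \<i> * E (var_dir \<kappa>' \<i>) v) / 2)) (at p)" for \<kappa>'
    unfolding wirtinger_conv_form_coeff[abs_def] form_coeff_def
    by (auto intro!: derivative_eq_intros E)
  then have eq: "wirtinger \<kappa> (wirtinger \<kappa>' f) p =
      form_coeff \<kappa> (\<lambda>v. (E (var_dir \<kappa>' 1) v + conj_sign \<kappa>' * \<i> * E (var_dir \<kappa>' \<i>) v) / 2)" for \<kappa> \<kappa>'
    by (rule wirtinger_eqI)
  show ?thesis
    unfolding eq form_coeff_def
    using sym[of "var_dir \<kappa> 1" "var_dir \<kappa>' 1"] sym[of "var_dir \<kappa> 1" "var_dir \<kappa>' \<i>"]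
      sym[of "var_dir \<kappa> \<i>" "var_dir \<kappa>' 1"] sym[of "var_dir \<kappa> \<i>" "var_dir \<kappa>' \<i>"]
    by (simp add: field_simps)
qed

lemma idx_eq_iff:
  assumes "i \<in> {1..CARD('i::{finite,linorder})}" "k \<in> {1..CARD('i)}"
  shows "(idx i :: 'i) = idx k \<longleftrightarrow> i = k"
  using assms bij_betw_idx[where 'i='i] by (auto simp: bij_betw_def inj_on_eq_iff)

lemma sum_idx: "(\<Sum>a\<in>UNIV. F (a :: 'i::{finite,linorder})) = (\<Sum>i=1..CARD('i). F (idx i))"
  using sum.reindex_bij_betw[OF bij_betw_idx[where 'i='i], of F] by simp

text \<open>The differentials of all variables and their conjugates span the real-linear forms. For a single
complex coordinate this is \<open>L c = a c + b cnj c\<close>, with \<open>a\<close> and \<open>b\<close> determined by \<open>L 1\<close> and \<open>L \<i>\<close>.\<close>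

lemma linear_eq_sum_form_coeff:
  fixes L :: "('m::{finite,linorder}, 'n::{finite,linorder}) point \<Rightarrow> complex"
  assumes "linear L"
  shows "L v =
    (\<Sum>i=1..CARD('m). form_coeff (Z i) L * (fst v $ idx i) + form_coeff (Zbar i) L * cnj (fst v $ idx i)) +
    (\<Sum>i=1..CARD('n). form_coeff (W i) L * (snd v $ idx i) + form_coeff (Wbar i) L * cnj (snd v $ idx i))"
proof -
  interpret linear L by fact
  have z: "L (zdir i c) = form_coeff (Z i) L * c + form_coeff (Zbar i) L * cnj c" for i c
  proof -
    have "(zdir i c :: ('m, 'n) point) = Re c *\<^sub>R zdir i 1 + Im c *\<^sub>R zdir i \<i>"
      by (simp add: zdir_def vec_eq_iff axis_def complex_eq_iff)
    then have "L (zdir i c) = Re c *\<^sub>R L (zdir i 1) + Im c *\<^sub>R L (zdir i \<i>)"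
      by (simp add: add scale)
    then show ?thesis
      by (simp add: form_coeff_def complex_eq_iff field_simps)
  qed
  have w: "L (wdir i c) = form_coeff (W i) L * c + form_coeff (Wbar i) L * cnj c" for i c
  proof -
    have "(wdir i c :: ('m, 'n) point) = Re c *\<^sub>R wdir i 1 + Im c *\<^sub>R wdir i \<i>"
      by (simp add: wdir_def vec_eq_iff axis_def complex_eq_iff)
    then have "L (wdir i c) = Re c *\<^sub>R L (wdir i 1) + Im c *\<^sub>R L (wdir i \<i>)"
      by (simp add: add scale)
    then show ?thesis
      by (simp add: form_coeff_def complex_eq_iff field_simps)
  qed
  have expand: "u = (\<Sum>i=1..CARD('k). axis (idx i) (u $ idx i))"
    for u :: "complex ^ 'k::{finite,linorder}"
    unfolding sum_idx[where F = "\<lambda>a. axis a (u $ a)", symmetric]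
    by (simp add: vec_eq_iff axis_def)
  have "v = (\<Sum>i=1..CARD('m). zdir i (fst v $ idx i)) + (\<Sum>i=1..CARD('n). wdir i (snd v $ idx i))"
    using expand[of "fst v"] expand[of "snd v"]
    by (simp add: prod_eq_iff fst_sum snd_sum zdir_def wdir_def)
  then have "L v = L ((\<Sum>i=1..CARD('m). zdir i (fst v $ idx i)) +
      (\<Sum>i=1..CARD('n). wdir i (snd v $ idx i)))"
    by (rule arg_cong)
  then show ?thesis
    by (simp only: add sum z w)
qed

lemma has_form_le: "has_form r V S f \<Longrightarrow> q \<le> r \<Longrightarrow> has_form q V S f"
  unfolding has_form_def by (blast intro: R_differentiable_on_le)

text \<open>A variable missing from \<open>f\<close> is missing from the derivatives of \<open>f\<close>, because the two
differentiations can be exchanged.\<close>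

lemma has_form_wirtinger:
  assumes "open S" "has_form 2 V S f"
  shows "has_form 1 V S (wirtinger \<kappa> f)"
  unfolding has_form_def
proof (intro conjI ballI)
  show "R_differentiable_on 1 S (wirtinger \<kappa> f)"
    using R_differentiable_on_wirtinger[OF assms(1), of 1 f] assms(2)
    by (simp add: has_form_def numeral_2_eq_2)
  fix \<kappa>' p assume "\<kappa>' \<in> V" "p \<in> S"
  then have "wirtinger \<kappa>' (wirtinger \<kappa> f) p = wirtinger \<kappa> (wirtinger \<kappa>' f) p"
    using assms by (intro wirtinger_commute) (auto simp: has_form_def)
  also have "\<dots> = wirtinger \<kappa> (\<lambda>p. 0) p"
    using assms \<open>\<kappa>' \<in> V\<close> \<open>p \<in> S\<close> by (intro wirtinger_cong[OF assms(1)]) (auto simp: has_form_def)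
  finally show "wirtinger \<kappa>' (wirtinger \<kappa> f) p = 0" by simp
qed

lemma has_form_exp:
  assumes "open S" "has_form 2 V S g"
  shows "has_form 2 V S (\<lambda>x. exp (g x))"
proof -
  have g: "g differentiable (at p)" "(\<lambda>q. frechet_derivative g (at q) v) differentiable (at p)"
    if "p \<in> S" for p v
    using assms that by (auto simp only: has_form_def intro: R_differentiable_on_2D)
  have D: "((\<lambda>x. exp (g x)) has_derivative (\<lambda>v. exp (g p) * frechet_derivative g (at p) v)) (at p)"
    if "p \<in> S" for p
    by (rule has_derivative_exp_comp) (use g that in \<open>simp add: frechet_derivative_works\<close>)
  have e: "(\<lambda>x. exp (g x)) differentiable (at p)" if "p \<in> S" for p
    using D[OF that] by (rule differentiableI)
  have "(\<lambda>p. frechet_derivative (\<lambda>x. exp (g x)) (at p) v) differentiable (at p)"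
    if "p \<in> S" for p v
  proof (rule differentiable_cong_open[OF assms(1) that])
    show "(\<lambda>p. exp (g p) * frechet_derivative g (at p) v) differentiable (at p)"
      by (intro differentiable_mult e g that)
    show "exp (g q) * frechet_derivative g (at q) v = frechet_derivative (\<lambda>x. exp (g x)) (at q) v"
      if "q \<in> S" for q
      using frechet_derivative_at[OF D[OF that]] by metis
  qed
  moreover have "wirtinger \<kappa> (\<lambda>x. exp (g x)) p = 0" if "\<kappa> \<in> V" "p \<in> S" for \<kappa> p
    using assms(2) that g(1)[OF that(2)] by (simp add: wirtinger_exp has_form_def)
  ultimately show ?thesis
    using e by (simp add: has_form_def R_differentiable_on_2)
qed

text \<open>On a simply connected set a continuous logarithm exists. Near each point it differs by a constant
from the principal logarithm of a quotient of values of \<open>\<mu>\<close>, which makes it differentiable; its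
derivative \<open>d\<mu> / \<mu>\<close> is then as smooth as that of \<open>\<mu>\<close> and involves the same variables.\<close>

lemma exists_logarithm_of_form:
  fixes \<mu> :: "('m::{finite,linorder}, 'n::{finite,linorder}) point \<Rightarrow> complex"
  assumes S: "open S" "simply_connected S" and \<mu>: "has_form 2 V S \<mu>" "\<And>x. x \<in> S \<Longrightarrow> \<mu> x \<noteq> 0"
  obtains g where "has_form 2 V S g" "\<And>x. x \<in> S \<Longrightarrow> \<mu> x = exp (g x)"
proof -
  have d\<mu>: "\<mu> differentiable (at p)" "(\<lambda>q. frechet_derivative \<mu> (at q) v) differentiable (at p)"
    if "p \<in> S" for p v
    using \<mu>(1) that by (auto simp only: has_form_def intro: R_differentiable_on_2D)
  have "continuous_on S \<mu>"
    using d\<mu>(1) by (meson continuous_at_imp_continuous_on differentiable_imp_continuous_within)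
  then obtain g where g: "continuous_on S g" "\<And>x. x \<in> S \<Longrightarrow> \<mu> x = exp (g x)"
    using continuous_logarithm_on_simply_connected[of S \<mu>] S \<mu>(2) open_imp_locally_path_connected
    by metis
  have dg: "g differentiable (at p)" if p: "p \<in> S" for p
  proof -
    \<comment> \<open>Where \<open>g\<close> differs from \<open>g p\<close> by less than \<open>1 < \<pi>\<close>, the principal branch recovers the difference.\<close>
    have "continuous_on S (\<lambda>x. norm (g x - g p))"
      by (intro continuous_intros g)
    then have "open (S \<inter> (\<lambda>x. norm (g x - g p)) -` {..<1})"
      using S(1) by (intro continuous_open_preimage) auto
    moreover have "(\<lambda>x. g p + Ln (\<mu> x / \<mu> p)) differentiable (at p)"
    proof -
      have "(Ln has_field_derivative inverse 1) (at 1)"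
        by (rule has_field_derivative_Ln) auto
      then have "(Ln has_field_derivative inverse 1) (at (\<mu> p / \<mu> p))"
        using \<mu>(2)[OF p] by simp
      then have "Ln differentiable (at (\<mu> p / \<mu> p))"
        by (auto simp: has_field_derivative_def differentiable_def)
      moreover have "(\<lambda>x. \<mu> x / \<mu> p) differentiable (at p)"
        using d\<mu>(1)[OF p] \<mu>(2)[OF p] by (intro differentiable_divide) auto
      ultimately show ?thesis
        using differentiable_chain_at[of "\<lambda>x. \<mu> x / \<mu> p" p Ln] by (intro differentiable_add) (auto simp: o_def)
    qed
    moreover have "g p + Ln (\<mu> x / \<mu> p) = g x" if "x \<in> S" "norm (g x - g p) < 1" for x
    proof -
      have "\<bar>Im (g x - g p)\<bar> < pi"
        using that(2) abs_Im_le_cmod[of "g x - g p"] pi_gt3 by linarith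
      then have "Ln (exp (g x - g p)) = g x - g p"
        by (intro Ln_exp) auto
      then show ?thesis
        using g(2) that(1) p by (simp add: exp_diff)
    qed
    ultimately show ?thesis
      using p differentiable_cong_open[of "S \<inter> (\<lambda>x. norm (g x - g p)) -` {..<1}" p
          "\<lambda>x. g p + Ln (\<mu> x / \<mu> p)" g] by auto
  qed
  have D: "frechet_derivative g (at p) v = frechet_derivative \<mu> (at p) v / \<mu> p" if "p \<in> S" for p v
  proof -
    have "frechet_derivative \<mu> (at p) = frechet_derivative (\<lambda>x. exp (g x)) (at p)"
      using g(2) by (rule frechet_derivative_cong_open[OF S(1) that])
    also have "\<dots> = (\<lambda>v. exp (g p) * frechet_derivative g (at p) v)"
      using has_derivative_exp_comp[OF dg[OF that, unfolded frechet_derivative_works]]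
      by (simp flip: frechet_derivative_at)
    finally show ?thesis using g(2) that by simp
  qed
  have "(\<lambda>q. frechet_derivative g (at q) v) differentiable (at p)" if "p \<in> S" for p v
  proof (rule differentiable_cong_open[OF S(1) that])
    show "(\<lambda>q. frechet_derivative \<mu> (at q) v / \<mu> q) differentiable (at p)"
      by (intro differentiable_divide d\<mu> that \<mu>)
  qed (simp add: D)
  moreover have "wirtinger \<kappa> g p = 0" if "\<kappa> \<in> V" "p \<in> S" for \<kappa> p
  proof -
    have "exp (g p) * wirtinger \<kappa> g p = wirtinger \<kappa> (\<lambda>x. exp (g x)) p"
      using dg that by (simp add: wirtinger_exp)
    also have "\<dots> = wirtinger \<kappa> \<mu> p"
      using that g(2) by (intro wirtinger_cong[OF S(1)]) auto
    finally show ?thesis using \<mu>(1) that by (simp add: has_form_def)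
  qed
  ultimately have "has_form 2 V S g"
    using dg by (simp add: has_form_def R_differentiable_on_2)
  then show ?thesis using that g(2) by blast
qed

section \<open>Multipliers, logarithms and the functional system\<close>

text \<open>The set \<open>V\<close> of missing variables is a parameter with a defining equation, rather than an
abbreviation: its type \<open>cvar set\<close> does not mention \<open>'m\<close> and \<open>'n\<close>, on which its value depends.\<close>

locale multiplier_setting =
  fixes X :: "nat \<Rightarrow> nat \<Rightarrow> ('m::{finite,linorder}, 'n::{finite,linorder}) point \<Rightarrow> complex"
    and S :: "('m, 'n) point set"
    and s1 s2 k1 k2 :: nat and j \<zeta> :: "nat \<Rightarrow> nat"
    and V :: "cvar set"
  assumes V_def: "V = missing_vars CARD('m) CARD('n) s1 s2 k1 k2 j \<zeta>"
    and open_S: "open S"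
    and X_diff: "\<And>\<xi> l. \<xi> \<in> {1..CARD('n)} \<Longrightarrow> l \<in> {1..2 * CARD('m)} \<Longrightarrow>
      R_differentiable_on (k1 + k2 + 1) S (X \<xi> l)"
    and le: "s1 \<le> CARD('m)" "s2 \<le> CARD('m)" "k1 \<le> CARD('n)" "k2 \<le> CARD('n)"
    and j: "j permutes {1..CARD('m)}" and \<zeta>: "\<zeta> permutes {1..CARD('n)}"
begin

abbreviation "dot \<equiv> phi_dot X k1 k2 \<zeta>"
abbreviation "\<omega> \<equiv> omega s1 s2 k1 k2 j \<zeta> :: _ \<Rightarrow> _ \<Rightarrow> _ \<Rightarrow> _ \<Rightarrow> ('m, 'n) point \<Rightarrow> ('m, 'n) point \<Rightarrow> complex"

lemma V_I:
  "s1 < i \<Longrightarrow> i \<le> CARD('m) \<Longrightarrow> Z i \<in> V"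
  "s2 < i \<Longrightarrow> i \<le> CARD('m) \<Longrightarrow> Zbar (j i) \<in> V"
  "k1 < i \<Longrightarrow> i \<le> CARD('n) \<Longrightarrow> W i \<in> V"
  "k2 < i \<Longrightarrow> i \<le> CARD('n) \<Longrightarrow> Wbar (\<zeta> i) \<in> V"
  by (auto simp: V_def missing_vars_def)

lemma perm_in:
  "j i \<in> {1..CARD('m)} \<longleftrightarrow> i \<in> {1..CARD('m)}" "\<zeta> i \<in> {1..CARD('n)} \<longleftrightarrow> i \<in> {1..CARD('n)}"
  using permutes_in_image[OF j] permutes_in_image[OF \<zeta>] by blast+

lemma perm_eq_iff: "j i = j i' \<longleftrightarrow> i = i'" "\<zeta> i = \<zeta> i' \<longleftrightarrow> i = i'"
  using permutes_inj[OF j] permutes_inj[OF \<zeta>] by (auto simp: inj_eq)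

text \<open>The coordinate direction of \<open>z\<^sub>i\<close> meets at most one unbarred summand of \<open>\<omega>\<close>, namely the \<open>i\<close>-th, and
at most one barred summand, namely the one with \<open>j g = i\<close>. The latter is left as a sum, which the
injectivity of \<open>j\<close> evaluates once \<open>i\<close> is written as a value of \<open>j\<close>.\<close>

lemma omega_zdir:
  assumes "i \<in> {1..CARD('m)}"
  shows "\<omega> \<psi>1 \<psi>2 \<phi>1 \<phi>2 x (zdir i c) = (if i \<le> s1 then \<psi>1 i x else 0) * c +
    (\<Sum>g=1..s2. if j g = i then \<psi>2 g x else 0) * cnj c"
proof -
  have 1: "\<psi>1 \<theta> x * (fst (zdir i c :: ('m, 'n) point) $ idx \<theta>) = (if i = \<theta> then \<psi>1 \<theta> x * c else 0)"
    if "\<theta> \<in> {1..s1}" for \<theta>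
    using that assms le(1) by (auto simp: zdir_def axis_def idx_eq_iff)
  have 2: "\<psi>2 g x * cnj (fst (zdir i c :: ('m, 'n) point) $ idx (j g)) =
      (if j g = i then \<psi>2 g x else 0) * cnj c"
    if "g \<in> {1..s2}" for g
  proof -
    have "j g \<in> {1..CARD('m)}" using that le(2) perm_in(1)[of g] by auto
    then show ?thesis using assms by (auto simp: zdir_def axis_def idx_eq_iff)
  qed
  have "\<omega> \<psi>1 \<psi>2 \<phi>1 \<phi>2 x (zdir i c) = (\<Sum>\<theta>=1..s1. if i = \<theta> then \<psi>1 \<theta> x * c else 0) +
      (\<Sum>g=1..s2. (if j g = i then \<psi>2 g x else 0) * cnj c)"
    unfolding omega_def by (simp add: 1 2) (simp add: zdir_def)
  then show ?thesis
    using assms by (simp add: sum_distrib_right)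
qed

lemma omega_wdir:
  assumes "i \<in> {1..CARD('n)}"
  shows "\<omega> \<psi>1 \<psi>2 \<phi>1 \<phi>2 x (wdir i c) = (if i \<le> k1 then \<phi>1 i x else 0) * c +
    (\<Sum>\<tau>=1..k2. if \<zeta> \<tau> = i then \<phi>2 \<tau> x else 0) * cnj c"
proof -
  have 1: "\<phi>1 \<xi> x * (snd (wdir i c :: ('m, 'n) point) $ idx \<xi>) = (if i = \<xi> then \<phi>1 \<xi> x * c else 0)"
    if "\<xi> \<in> {1..k1}" for \<xi>
    using that assms le(3) by (auto simp: wdir_def axis_def idx_eq_iff)
  have 2: "\<phi>2 \<tau> x * cnj (snd (wdir i c :: ('m, 'n) point) $ idx (\<zeta> \<tau>)) =
      (if \<zeta> \<tau> = i then \<phi>2 \<tau> x else 0) * cnj c"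
    if "\<tau> \<in> {1..k2}" for \<tau>
  proof -
    have "\<zeta> \<tau> \<in> {1..CARD('n)}" using that le(4) perm_in(2)[of \<tau>] by auto
    then show ?thesis using assms by (auto simp: wdir_def axis_def idx_eq_iff)
  qed
  have "\<omega> \<psi>1 \<psi>2 \<phi>1 \<phi>2 x (wdir i c) = (\<Sum>\<xi>=1..k1. if i = \<xi> then \<phi>1 \<xi> x * c else 0) +
      (\<Sum>\<tau>=1..k2. (if \<zeta> \<tau> = i then \<phi>2 \<tau> x else 0) * cnj c)"
    unfolding omega_def by (simp add: 1 2) (simp add: wdir_def)
  then show ?thesis
    using assms by (simp add: sum_distrib_right)
qed

lemma form_coeff_omega:
  "i \<in> {1..CARD('m)} \<Longrightarrow> form_coeff (Z i) (\<omega> \<psi>1 \<psi>2 \<phi>1 \<phi>2 x) = (if i \<le> s1 then \<psi>1 i x else 0)"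
  "i \<in> {1..CARD('m)} \<Longrightarrow> form_coeff (Zbar (j i)) (\<omega> \<psi>1 \<psi>2 \<phi>1 \<phi>2 x) = (if i \<le> s2 then \<psi>2 i x else 0)"
  "i \<in> {1..CARD('n)} \<Longrightarrow> form_coeff (W i) (\<omega> \<psi>1 \<psi>2 \<phi>1 \<phi>2 x) = (if i \<le> k1 then \<phi>1 i x else 0)"
  "i \<in> {1..CARD('n)} \<Longrightarrow> form_coeff (Wbar (\<zeta> i)) (\<omega> \<psi>1 \<psi>2 \<phi>1 \<phi>2 x) = (if i \<le> k2 then \<phi>2 i x else 0)"
proof -
  show "form_coeff (Z i) (\<omega> \<psi>1 \<psi>2 \<phi>1 \<phi>2 x) = (if i \<le> s1 then \<psi>1 i x else 0)" if "i \<in> {1..CARD('m)}"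
    unfolding form_coeff_def var_dir.simps omega_zdir[OF that] by (simp add: field_simps)
  show "form_coeff (W i) (\<omega> \<psi>1 \<psi>2 \<phi>1 \<phi>2 x) = (if i \<le> k1 then \<phi>1 i x else 0)" if "i \<in> {1..CARD('n)}"
    unfolding form_coeff_def var_dir.simps omega_wdir[OF that] by (simp add: field_simps)
  show "form_coeff (Zbar (j i)) (\<omega> \<psi>1 \<psi>2 \<phi>1 \<phi>2 x) = (if i \<le> s2 then \<psi>2 i x else 0)"
    if "i \<in> {1..CARD('m)}"
  proof -
    have "j i \<in> {1..CARD('m)}" using that by (simp only: perm_in)
    from omega_zdir[OF this] show ?thesis
      using that by (simp add: form_coeff_def perm_eq_iff field_simps)
  qed
  show "form_coeff (Wbar (\<zeta> i)) (\<omega> \<psi>1 \<psi>2 \<phi>1 \<phi>2 x) = (if i \<le> k2 then \<phi>2 i x else 0)"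
    if "i \<in> {1..CARD('n)}"
  proof -
    have "\<zeta> i \<in> {1..CARD('n)}" using that by (simp only: perm_in)
    from omega_wdir[OF this] show ?thesis
      using that by (simp add: form_coeff_def perm_eq_iff field_simps)
  qed
qed

text \<open>In the expansion of \<open>dg\<close> by all variables the missing ones contribute nothing, and the rest is
\<open>\<omega>\<close> after the barred variables have been renumbered by \<open>j\<close> and \<open>\<zeta>\<close>.\<close>

lemma frechet_derivative_eq_omega:
  assumes g: "g differentiable (at x)" and V: "\<And>\<kappa>. \<kappa> \<in> V \<Longrightarrow> wirtinger \<kappa> g x = 0"
  shows "frechet_derivative g (at x) =
    \<omega> (\<lambda>\<theta>. wirtinger (Z \<theta>) g) (\<lambda>i. wirtinger (Zbar (j i)) g)
       (\<lambda>\<xi>. wirtinger (W \<xi>) g) (\<lambda>\<tau>. wirtinger (Wbar (\<zeta> \<tau>)) g) x"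
    (is "?D = ?\<omega>")
proof
  fix v :: "('m, 'n) point"
  have "linear ?D" using g by (rule linear_frechet_derivative)
  have 1: "(\<Sum>i=1..CARD('m). form_coeff (Z i) ?D * (fst v $ idx i)) =
      (\<Sum>i=1..s1. wirtinger (Z i) g x * (fst v $ idx i))"
    using le V V_I by (intro sum.mono_neutral_cong_right) (auto simp: wirtinger_conv_form_coeff)
  have 3: "(\<Sum>i=1..CARD('n). form_coeff (W i) ?D * (snd v $ idx i)) =
      (\<Sum>i=1..k1. wirtinger (W i) g x * (snd v $ idx i))"
    using le V V_I by (intro sum.mono_neutral_cong_right) (auto simp: wirtinger_conv_form_coeff)
  have "(\<Sum>i=1..CARD('m). form_coeff (Zbar i) ?D * cnj (fst v $ idx i)) =
      (\<Sum>i=1..CARD('m). form_coeff (Zbar (j i)) ?D * cnj (fst v $ idx (j i)))"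
    by (rule sum.reindex_bij_betw[OF permutes_imp_bij[OF j], symmetric])
  also have "\<dots> = (\<Sum>i=1..s2. wirtinger (Zbar (j i)) g x * cnj (fst v $ idx (j i)))"
    using le V V_I by (intro sum.mono_neutral_cong_right) (auto simp: wirtinger_conv_form_coeff)
  finally have 2: "(\<Sum>i=1..CARD('m). form_coeff (Zbar i) ?D * cnj (fst v $ idx i)) = \<dots>" .
  have "(\<Sum>i=1..CARD('n). form_coeff (Wbar i) ?D * cnj (snd v $ idx i)) =
      (\<Sum>i=1..CARD('n). form_coeff (Wbar (\<zeta> i)) ?D * cnj (snd v $ idx (\<zeta> i)))"
    by (rule sum.reindex_bij_betw[OF permutes_imp_bij[OF \<zeta>], symmetric])
  also have "\<dots> = (\<Sum>i=1..k2. wirtinger (Wbar (\<zeta> i)) g x * cnj (snd v $ idx (\<zeta> i)))"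
    using le V V_I by (intro sum.mono_neutral_cong_right) (auto simp: wirtinger_conv_form_coeff)
  finally have 4: "(\<Sum>i=1..CARD('n). form_coeff (Wbar i) ?D * cnj (snd v $ idx i)) = \<dots>" .
  show "?D v = ?\<omega> v"
    unfolding linear_eq_sum_form_coeff[OF \<open>linear ?D\<close>, of v] sum.distrib 1 2 3 4 omega_def by simp
qed

text \<open>For \<open>g\<close> without the variables in \<open>V\<close>, the operator reduces to the left-hand side of an
underived equation of the system: \<open>wirtinger (tvar CARD('m) l) g\<close> is the corresponding component of
\<open>\<psi>\<close>, or zero if that variable is missing.\<close>

lemma frakX_eq_dot:
  assumes V: "\<And>\<kappa>. \<kappa> \<in> V \<Longrightarrow> wirtinger \<kappa> g x = 0"
    and \<phi>1: "\<And>\<xi>. \<xi> \<in> {1..k1} \<Longrightarrow> \<phi>1 \<xi> x = wirtinger (W \<xi>) g x"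
    and \<phi>2: "\<And>\<tau>. \<tau> \<in> {1..k2} \<Longrightarrow> \<phi>2 \<tau> x = wirtinger (Wbar (\<zeta> \<tau>)) g x"
  shows "frakX X l g x = wirtinger (tvar CARD('m) l) g x + dot \<phi>1 \<phi>2 (\<lambda>f. f) l x"
proof -
  have 1: "(\<Sum>\<xi>=1..CARD('n). X \<xi> l x * wirtinger (W \<xi>) g x) = (\<Sum>\<xi>=1..k1. \<phi>1 \<xi> x * X \<xi> l x)"
    using le V V_I by (intro sum.mono_neutral_cong_right) (auto simp: \<phi>1)
  have "(\<Sum>\<xi>=1..CARD('n). cnj (X \<xi> (opp CARD('m) l) x) * wirtinger (Wbar \<xi>) g x) =
      (\<Sum>\<tau>=1..CARD('n). cnj (X (\<zeta> \<tau>) (opp CARD('m) l) x) * wirtinger (Wbar (\<zeta> \<tau>)) g x)"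
    by (rule sum.reindex_bij_betw[OF permutes_imp_bij[OF \<zeta>], symmetric])
  also have "\<dots> = (\<Sum>\<tau>=1..k2. \<phi>2 \<tau> x * cnj (X (\<zeta> \<tau>) (opp CARD('m) l) x))"
    using le V V_I by (intro sum.mono_neutral_cong_right) (auto simp: \<phi>2)
  finally show ?thesis
    unfolding frakX_def phi_dot_def sum.distrib 1 by simp
qed

lemma frakX_exp:
  assumes "g differentiable (at x)"
  shows "frakX X l (\<lambda>x. exp (g x)) x = exp (g x) * frakX X l g x"
  unfolding frakX_def wirtinger_exp[OF assms]
  by (simp add: distrib_left sum_distrib_left mult_ac)

text \<open>The equations of the system are numbered through \<open>j\<close> in their barred half, so an arbitrary index
has to be brought into the shape \<open>m + j i\<close>.\<close>

lemma tvar_cases: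
  assumes "l \<in> {1..2 * CARD('m)}"
  obtains (unbarred) "l \<in> {1..CARD('m)}" "tvar CARD('m) l = Z l"
  | (barred) i where "i \<in> {1..CARD('m)}" "l = CARD('m) + j i" "tvar CARD('m) l = Zbar (j i)"
proof (cases "l \<le> CARD('m)")
  case True
  then show ?thesis using assms unbarred by (simp add: tvar_def)
next
  case False
  then have "l - CARD('m) \<in> j ` {1..CARD('m)}"
    unfolding permutes_image[OF j] using assms by auto
  then obtain i where "i \<in> {1..CARD('m)}" "l = CARD('m) + j i" using False by auto
  then show ?thesis using barred False by (simp add: tvar_def)
qed

lemma opp_in: "l \<in> {1..2 * CARD('m)} \<Longrightarrow> opp CARD('m) l \<in> {1..2 * CARD('m)}"
  by (auto simp: opp_def)

lemma cnj_X_diff: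
  assumes "\<xi> \<in> {1..CARD('n)}" "l \<in> {1..2 * CARD('m)}"
  shows "R_differentiable_on (k1 + k2 + 1) S (\<lambda>y. cnj (X \<xi> (opp CARD('m) l) y))"
  using R_differentiable_on_bounded_linear[OF open_S bounded_linear_cnj X_diff[OF assms(1) opp_in[OF assms(2)]]] .

lemma divX_diff:
  assumes "l \<in> {1..2 * CARD('m)}"
  shows "R_differentiable_on (k1 + k2) S (\<lambda>x. - divX X l x)"
proof -
  have "R_differentiable_on (k1 + k2) S (divX X l)"
    unfolding divX_def[abs_def]
    using X_diff[OF _ assms] cnj_X_diff[OF _ assms]
    by (intro R_differentiable_on_sum R_differentiable_on_add R_differentiable_on_wirtinger open_S)
       (simp_all del: R_differentiable_on.simps)
  then show ?thesis
    by (rule R_differentiable_on_bounded_linear[OF open_S bounded_linear_minus[OF bounded_linear_ident]])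
qed

text \<open>Since \<open>h\<close> and the \<open>\<phi>\<close> do not involve the variable \<open>\<kappa>\<close>, differentiation with respect to it passes by
the product rule to the coefficients \<open>X\<close> and removes \<open>h\<close>. Iteration is possible as long as the last
function to be differentiated is differentiable, which \<open>k1 + k2 + 1\<close> derivatives of \<open>X\<close> and \<open>k1 + k2\<close>
derivatives of the right-hand side guarantee up to order \<open>k1 + k2\<close>.\<close>

lemma derived_equations:
  assumes l: "l \<in> {1..2 * CARD('m)}" and \<kappa>: "\<kappa> \<in> V"
    and \<phi>1: "\<And>\<xi>. \<xi> \<in> {1..k1} \<Longrightarrow> has_form 1 V S (\<phi>1 \<xi>)"
    and \<phi>2: "\<And>\<tau>. \<tau> \<in> {1..k2} \<Longrightarrow> has_form 1 V S (\<phi>2 \<tau>)"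
    and h: "has_form 1 V S h"
    and H: "R_differentiable_on (k1 + k2) S H"
    and eq: "\<And>x. x \<in> S \<Longrightarrow> h x + dot \<phi>1 \<phi>2 (\<lambda>f. f) l x = H x"
    and p: "1 \<le> p" "p \<le> k1 + k2" and x: "x \<in> S"
  shows "dot \<phi>1 \<phi>2 (wirtinger \<kappa> ^^ p) l x = (wirtinger \<kappa> ^^ p) H x"
proof -
  let ?D = "\<lambda>p. wirtinger \<kappa> ^^ p"
  let ?h = "\<lambda>p x. if p = 0 then h x else 0"
  have formD: "f differentiable (at x)" "wirtinger \<kappa> f x = 0" if "has_form 1 V S f" "x \<in> S" for f x
    using that \<kappa> by (auto simp only: has_form_def R_differentiable_on_1)
  have smooth: "(?D q f) differentiable (at x)"
    if "R_differentiable_on (k1 + k2 + 1) S f" "q \<le> k1 + k2" "x \<in> S" for q f x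
  proof -
    have "R_differentiable_on (1 + q) S f"
      using that(1) by (rule R_differentiable_on_le) (use that in simp)
    from R_differentiable_on_wirtinger_funpow[OF open_S this] show ?thesis
      using that(3) unfolding R_differentiable_on_1 by blast
  qed
  \<comment> \<open>Keeping \<open>h\<close> in the induction for order zero only lets the undifferentiated equation serve as
    the base case.\<close>
  have "\<forall>x\<in>S. ?h p x + dot \<phi>1 \<phi>2 (?D p) l x = ?D p H x"
    using p(2)
  proof (induction p)
    case 0
    then show ?case using eq by (simp add: id_def)
  next
    case (Suc p)
    show ?case
    proof
      fix x assume x: "x \<in> S"
      have f1: "(?D p (X \<xi> l)) differentiable (at x)" if "\<xi> \<in> {1..k1}" for \<xi>
        using X_diff[OF _ l, of \<xi>] that le Suc.prems x by (intro smooth) auto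
      have f2: "(?D p (\<lambda>y. cnj (X (\<zeta> \<tau>) (opp CARD('m) l) y))) differentiable (at x)"
        if "\<tau> \<in> {1..k2}" for \<tau>
      proof -
        have "\<zeta> \<tau> \<in> {1..CARD('n)}" unfolding perm_in using that le by auto
        then show ?thesis using cnj_X_diff[OF _ l] Suc.prems x by (intro smooth) auto
      qed
      have a: "\<phi>1 \<xi> differentiable (at x)" "wirtinger \<kappa> (\<phi>1 \<xi>) x = 0" if "\<xi> \<in> {1..k1}" for \<xi>
        using formD[OF \<phi>1[OF that] x] by auto
      have b: "\<phi>2 \<tau> differentiable (at x)" "wirtinger \<kappa> (\<phi>2 \<tau>) x = 0" if "\<tau> \<in> {1..k2}" for \<tau>
        using formD[OF \<phi>2[OF that] x] by auto
      have hd: "?h p differentiable (at x)" "wirtinger \<kappa> (?h p) x = 0"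
        using formD[OF h x] by (cases p; simp)+
      have "?D (Suc p) H x = wirtinger \<kappa> (\<lambda>y. ?h p y + dot \<phi>1 \<phi>2 (?D p) l y) x"
        using Suc by (auto intro!: wirtinger_cong[OF open_S x])
      also have "\<dots> = dot \<phi>1 \<phi>2 (?D (Suc p)) l x"
      proof -
        let ?F = "\<lambda>\<xi> y. \<phi>1 \<xi> y * ?D p (X \<xi> l) y"
        let ?G = "\<lambda>\<tau> y. \<phi>2 \<tau> y * ?D p (\<lambda>y. cnj (X (\<zeta> \<tau>) (opp CARD('m) l) y)) y"
        have F: "?F \<xi> differentiable (at x)"
          "wirtinger \<kappa> (?F \<xi>) x = \<phi>1 \<xi> x * ?D (Suc p) (X \<xi> l) x" if "\<xi> \<in> {1..k1}" for \<xi>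
          using wirtinger_mult[OF a(1)[OF that] f1[OF that]] a(2)[OF that]
            differentiable_mult[OF a(1)[OF that] f1[OF that]] by simp_all
        have G: "?G \<tau> differentiable (at x)" "wirtinger \<kappa> (?G \<tau>) x =
            \<phi>2 \<tau> x * ?D (Suc p) (\<lambda>y. cnj (X (\<zeta> \<tau>) (opp CARD('m) l) y)) x" if "\<tau> \<in> {1..k2}" for \<tau>
          using wirtinger_mult[OF b(1)[OF that] f2[OF that]] b(2)[OF that]
            differentiable_mult[OF b(1)[OF that] f2[OF that]] by simp_all
        have "wirtinger \<kappa> (\<lambda>y. ?h p y + ((\<Sum>\<xi>=1..k1. ?F \<xi> y) + (\<Sum>\<tau>=1..k2. ?G \<tau> y))) x =
            wirtinger \<kappa> (?h p) x +
            ((\<Sum>\<xi>=1..k1. wirtinger \<kappa> (?F \<xi>) x) + (\<Sum>\<tau>=1..k2. wirtinger \<kappa> (?G \<tau>) x))"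
          using F(1) G(1) hd(1)
          by (subst wirtinger_add wirtinger_sum; (intro differentiable_add differentiable_sum ballI)?; simp)+
        then show ?thesis
          unfolding phi_dot_def hd(2) by (simp add: F(2) G(2))
      qed
      finally show "?h (Suc p) x + dot \<phi>1 \<phi>2 (?D (Suc p)) l x = ?D (Suc p) H x"
        by simp
    qed
  qed
  then show ?thesis using p(1) x by simp
qed

text \<open>Comparison of coefficients in \<open>dg = \<omega>\<close> identifies \<open>\<psi>\<close> and \<open>\<phi>\<close> with the Wirtinger derivatives of \<open>g\<close>;
the underived equations of the system then are the multiplier equations for \<open>log \<mu> = g\<close>.\<close>

lemma frakX_from_solution:
  assumes E: "E_solution X S s1 s2 k1 k2 j \<zeta> \<psi>1 \<psi>2 \<phi>1 \<phi>2"
    and g: "form_integral V S (\<omega> \<psi>1 \<psi>2 \<phi>1 \<phi>2) g"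
    and l: "l \<in> {1..2 * CARD('m)}" and x: "x \<in> S"
  shows "frakX X l g x = - divX X l x"
proof -
  have D: "(g has_derivative \<omega> \<psi>1 \<psi>2 \<phi>1 \<phi>2 x) (at x)"
    using g x by (simp add: form_integral_def)
  note w = wirtinger_eqI[OF D]
  have "frakX X l g x = wirtinger (tvar CARD('m) l) g x + dot \<phi>1 \<phi>2 (\<lambda>f. f) l x"
  proof (rule frakX_eq_dot)
    show "wirtinger \<kappa> g x = 0" if "\<kappa> \<in> V" for \<kappa>
      using g that x by (auto simp only: form_integral_def has_form_def)
  qed (use le in \<open>auto simp: w form_coeff_omega\<close>)
  moreover have E': "system_E X (\<lambda>l x. - divX X l x) S s1 s2 k1 k2 j \<zeta> \<psi>1 \<psi>2 \<phi>1 \<phi>2"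
    using E by (simp add: E_solution_def Let_def V_def[symmetric])
  note E'' = E'[unfolded system_E_def Let_def V_def[symmetric], rule_format, OF x]
  from l have "wirtinger (tvar CARD('m) l) g x + dot \<phi>1 \<phi>2 (\<lambda>f. f) l x = - divX X l x"
  proof (cases rule: tvar_cases)
    case unbarred
    then show ?thesis
      using E'' by (cases "l \<le> s1") (auto simp: w form_coeff_omega)
  next
    case (barred i)
    then show ?thesis
      using E'' by (cases "i \<le> s2") (auto simp: w form_coeff_omega)
  qed
  ultimately show ?thesis by simp
qed

text \<open>The coefficients of \<open>\<omega>\<close> are differentiable, so \<open>dg = \<omega>\<close> gives \<open>g\<close> one derivative more than an
integral has by definition.\<close>

lemma integral_has_form_2:
  assumes E: "E_solution X S s1 s2 k1 k2 j \<zeta> \<psi>1 \<psi>2 \<phi>1 \<phi>2"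
    and g: "form_integral V S (\<omega> \<psi>1 \<psi>2 \<phi>1 \<phi>2) g"
  shows "has_form 2 V S g"
proof -
  have D: "(g has_derivative \<omega> \<psi>1 \<psi>2 \<phi>1 \<phi>2 x) (at x)" if "x \<in> S" for x
    using g that by (simp add: form_integral_def)
  have form: "f differentiable (at x)" if "has_form 1 V S f" "x \<in> S" for f x
    using that by (auto simp only: has_form_def R_differentiable_on_1)
  have coeff: "\<theta> \<in> {1..s1} \<Longrightarrow> \<psi>1 \<theta> differentiable (at x)" "i \<in> {1..s2} \<Longrightarrow> \<psi>2 i differentiable (at x)"
    "\<xi> \<in> {1..k1} \<Longrightarrow> \<phi>1 \<xi> differentiable (at x)" "\<tau> \<in> {1..k2} \<Longrightarrow> \<phi>2 \<tau> differentiable (at x)"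
    if "x \<in> S" for x \<theta> i \<xi> \<tau>
    using E that by (auto simp only: E_solution_def Let_def V_def[symmetric] intro!: form)
  have "(\<lambda>q. frechet_derivative g (at q) v) differentiable (at x)" if "x \<in> S" for x v
  proof (rule differentiable_cong_open[OF open_S that])
    show "(\<lambda>x. \<omega> \<psi>1 \<psi>2 \<phi>1 \<phi>2 x v) differentiable (at x)"
      unfolding omega_def
      by (intro differentiable_add differentiable_sum finite_atLeastAtMost ballI differentiable_mult
          differentiable_const coeff that)
    show "\<omega> \<psi>1 \<psi>2 \<phi>1 \<phi>2 q v = frechet_derivative g (at q) v" if "q \<in> S" for q
      using frechet_derivative_at[OF D[OF that]] by metis
  qed
  then show ?thesis
    using g by (simp add: form_integral_def has_form_def R_differentiable_on_1 R_differentiable_on_2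
        del: One_nat_def split_paired_All)
qed

lemma form_last_multiplier_exp_integral:
  assumes "S \<noteq> {}"
    and E: "E_solution X S s1 s2 k1 k2 j \<zeta> \<psi>1 \<psi>2 \<phi>1 \<phi>2"
    and g: "form_integral V S (\<omega> \<psi>1 \<psi>2 \<phi>1 \<phi>2) g"
  shows "form_last_multiplier X S s1 s2 k1 k2 j \<zeta> (\<lambda>x. exp (g x))"
proof -
  have gd: "g differentiable (at x)" if "x \<in> S" for x
    using g that by (auto simp: form_integral_def intro: differentiableI)
  have form: "has_form 2 V S (\<lambda>x. exp (g x))"
    by (intro has_form_exp open_S integral_has_form_2[OF E g])
  have "R_differentiable_on 1 S (\<lambda>x. exp (g x))"
    using has_form_le[OF form, of 1] by (simp add: has_form_def)
  moreover have "frakX X l (\<lambda>x. exp (g x)) x = - exp (g x) * divX X l x"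
    if "l \<in> {1..2 * CARD('m)}" "x \<in> S" for l x
    using frakX_exp[OF gd[OF that(2)]] frakX_from_solution[OF E g that] by simp
  ultimately show ?thesis
    using form \<open>S \<noteq> {}\<close> by (auto simp only: form_last_multiplier_def V_def[symmetric] last_multiplier_def exp_not_eq_zero)
qed

text \<open>The derivatives of \<open>g = log \<mu>\<close> solve the system: the underived equations restate the multiplier
equations, and the others follow from them by differentiation.\<close>

lemma solution_from_log_multiplier:
  assumes g: "has_form 2 V S g"
    and eq: "\<And>l x. l \<in> {1..2 * CARD('m)} \<Longrightarrow> x \<in> S \<Longrightarrow> frakX X l g x = - divX X l x"
  shows "E_solution X S s1 s2 k1 k2 j \<zeta>
      (\<lambda>\<theta>. wirtinger (Z \<theta>) g) (\<lambda>i. wirtinger (Zbar (j i)) g)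
      (\<lambda>\<xi>. wirtinger (W \<xi>) g) (\<lambda>\<tau>. wirtinger (Wbar (\<zeta> \<tau>)) g)"
    (is "E_solution _ _ _ _ _ _ _ _ ?\<psi>1 ?\<psi>2 ?\<phi>1 ?\<phi>2")
proof -
  have V: "wirtinger \<kappa> g x = 0" if "\<kappa> \<in> V" "x \<in> S" for \<kappa> x
    using g that by (simp only: has_form_def)
  note form = has_form_wirtinger[OF open_S g]
  have base: "wirtinger (tvar CARD('m) l) g x + dot ?\<phi>1 ?\<phi>2 (\<lambda>f. f) l x = - divX X l x"
    if "l \<in> {1..2 * CARD('m)}" "x \<in> S" for l x
    using frakX_eq_dot[of g x ?\<phi>1 ?\<phi>2 l] V eq[OF that] that by simp
  have derived: "dot ?\<phi>1 ?\<phi>2 (wirtinger \<kappa> ^^ p) l x = (wirtinger \<kappa> ^^ p) (\<lambda>x. - divX X l x) x"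
    if "l \<in> {1..2 * CARD('m)}" "x \<in> S" "\<kappa> \<in> V" "p \<in> {1..k1 + k2}" for l x \<kappa> p
    by (rule derived_equations[where h = "wirtinger (tvar CARD('m) l) g"])
       (use that form base divX_diff in auto)
  have l1: "l \<in> {1..2 * CARD('m)}" "tvar CARD('m) l = Z l" if "1 \<le> l" "l \<le> CARD('m)" for l
    using that by (auto simp: tvar_def)
  have l2: "CARD('m) + j i \<in> {1..2 * CARD('m)}" "tvar CARD('m) (CARD('m) + j i) = Zbar (j i)"
    if "1 \<le> i" "i \<le> CARD('m)" for i
    using that perm_in(1)[of i] by (auto simp: tvar_def)
  have "system_E X (\<lambda>l x. - divX X l x) S s1 s2 k1 k2 j \<zeta> ?\<psi>1 ?\<psi>2 ?\<phi>1 ?\<phi>2"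
    unfolding system_E_def Let_def V_def[symmetric]
  proof (intro ballI conjI)
    fix x assume x: "x \<in> S"
    {
      fix \<theta> assume \<theta>: "\<theta> \<in> {1..s1}"
      then have l: "\<theta> \<in> {1..2 * CARD('m)}" "tvar CARD('m) \<theta> = Z \<theta>" using l1[of \<theta>] le by auto
      show "?\<psi>1 \<theta> x + dot ?\<phi>1 ?\<phi>2 (\<lambda>f. f) \<theta> x = - divX X \<theta> x"
        using base[OF l(1) x] l(2) by simp
      show "dot ?\<phi>1 ?\<phi>2 (wirtinger \<kappa> ^^ p) \<theta> x = (wirtinger \<kappa> ^^ p) (\<lambda>x. - divX X \<theta> x) x"
        if "\<kappa> \<in> V" "p \<in> {1..k1 + k2}" for \<kappa> p
        using derived[OF l(1) x that] .
    next
      fix \<eta> assume \<eta>: "\<eta> \<in> {s1 + 1..CARD('m)}"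
      then have l: "\<eta> \<in> {1..2 * CARD('m)}" "tvar CARD('m) \<eta> = Z \<eta>" using l1[of \<eta>] by auto
      show "dot ?\<phi>1 ?\<phi>2 (\<lambda>f. f) \<eta> x = - divX X \<eta> x"
        using base[OF l(1) x] l(2) V[OF V_I(1)[of \<eta>] x] \<eta> by simp
      show "dot ?\<phi>1 ?\<phi>2 (wirtinger \<kappa> ^^ p) \<eta> x = (wirtinger \<kappa> ^^ p) (\<lambda>x. - divX X \<eta> x) x"
        if "\<kappa> \<in> V" "p \<in> {1..k1 + k2 - 1}" for \<kappa> p
        using that by (intro derived[OF l(1) x]) auto
    next
      fix i assume i: "i \<in> {1..s2}"
      then have l: "CARD('m) + j i \<in> {1..2 * CARD('m)}"
          "tvar CARD('m) (CARD('m) + j i) = Zbar (j i)" using l2[of i] le by auto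
      show "?\<psi>2 i x + dot ?\<phi>1 ?\<phi>2 (\<lambda>f. f) (CARD('m) + j i) x = - divX X (CARD('m) + j i) x"
        using base[OF l(1) x] l(2) by simp
      show "dot ?\<phi>1 ?\<phi>2 (wirtinger \<kappa> ^^ p) (CARD('m) + j i) x =
          (wirtinger \<kappa> ^^ p) (\<lambda>x. - divX X (CARD('m) + j i) x) x"
        if "\<kappa> \<in> V" "p \<in> {1..k1 + k2}" for \<kappa> p
        using derived[OF l(1) x that] .
    next
      fix i assume i: "i \<in> {s2 + 1..CARD('m)}"
      then have l: "CARD('m) + j i \<in> {1..2 * CARD('m)}"
          "tvar CARD('m) (CARD('m) + j i) = Zbar (j i)" using l2[of i] by auto
      show "dot ?\<phi>1 ?\<phi>2 (\<lambda>f. f) (CARD('m) + j i) x = - divX X (CARD('m) + j i) x"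
        using base[OF l(1) x] l(2) V[OF V_I(2)[of i] x] i by simp
      show "dot ?\<phi>1 ?\<phi>2 (wirtinger \<kappa> ^^ p) (CARD('m) + j i) x =
          (wirtinger \<kappa> ^^ p) (\<lambda>x. - divX X (CARD('m) + j i) x) x"
        if "\<kappa> \<in> V" "p \<in> {1..k1 + k2 - 1}" for \<kappa> p
        using that by (intro derived[OF l(1) x]) auto
    }
  qed
  then show ?thesis
    using form by (auto simp only: E_solution_def Let_def V_def[symmetric])
qed

lemma integrating_factor_from_multiplier:
  assumes S: "simply_connected S"
    and \<mu>: "form_last_multiplier X S s1 s2 k1 k2 j \<zeta> \<mu>" "\<And>x. x \<in> S \<Longrightarrow> \<mu> x \<noteq> 0"
  shows "\<exists>\<psi>1 \<psi>2 \<phi>1 \<phi>2. E_solution X S s1 s2 k1 k2 j \<zeta> \<psi>1 \<psi>2 \<phi>1 \<phi>2 \<and>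
    has_integrating_factor_1 V S (\<omega> \<psi>1 \<psi>2 \<phi>1 \<phi>2)"
proof -
  have "has_form 2 V S \<mu>" using \<mu>(1) by (simp add: form_last_multiplier_def V_def[symmetric])
  then obtain g where g: "has_form 2 V S g" and exp: "\<And>x. x \<in> S \<Longrightarrow> \<mu> x = exp (g x)"
    using exists_logarithm_of_form[OF open_S S] \<mu>(2) by blast
  have gd: "g differentiable (at x)" if "x \<in> S" for x
    using g that by (auto simp only: has_form_def intro: R_differentiable_on_2D)
  have eq: "frakX X l g x = - divX X l x" if l: "l \<in> {1..2 * CARD('m)}" and x: "x \<in> S" for l x
  proof -
    have "exp (g x) * frakX X l g x = frakX X l (\<lambda>x. exp (g x)) x"
      using frakX_exp[OF gd[OF x]] by simp
    also have "\<dots> = frakX X l \<mu> x"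
      unfolding frakX_def by (simp only: wirtinger_cong[OF open_S x exp])
    also have "\<dots> = exp (g x) * - divX X l x"
      using \<mu>(1) l x exp[OF x] by (simp add: form_last_multiplier_def last_multiplier_def)
    finally show ?thesis unfolding mult_cancel_left by simp
  qed
  let ?\<omega> = "\<omega> (\<lambda>\<theta>. wirtinger (Z \<theta>) g) (\<lambda>i. wirtinger (Zbar (j i)) g)
      (\<lambda>\<xi>. wirtinger (W \<xi>) g) (\<lambda>\<tau>. wirtinger (Wbar (\<zeta> \<tau>)) g)"
  have "(g has_derivative ?\<omega> x) (at x)" if "x \<in> S" for x
  proof -
    have "frechet_derivative g (at x) = ?\<omega> x"
      using g that by (intro frechet_derivative_eq_omega gd) (auto simp only: has_form_def)
    then show ?thesis using gd[OF that] by (simp add: frechet_derivative_works)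
  qed
  moreover have "has_form 1 V S g"
    using g by (rule has_form_le) simp
  ultimately have "has_integrating_factor_1 V S ?\<omega>"
    by (auto simp only: has_integrating_factor_1_def form_integral_def)
  then show ?thesis using solution_from_log_multiplier[OF g eq] by blast
qed

end

theorem theorem1p10:
  fixes G G' :: "('m::{finite,linorder}, 'n::{finite,linorder}) point set"
    and X :: "nat \<Rightarrow> nat \<Rightarrow> ('m, 'n) point \<Rightarrow> complex"
    and s1 s2 k1 k2 :: nat
    and j \<zeta> :: "nat \<Rightarrow> nat"
  assumes "domain_in G" and "domain_in G'" and "G' \<subseteq> G"
    and "\<forall>\<xi>\<in>{1..CARD('n)}. \<forall>l\<in>{1..2 * CARD('m)}. R_differentiable_on (k1 + k2 + 1) G (X \<xi> l)"
    and "s1 \<le> CARD('m)" and "s2 \<le> CARD('m)" and "k1 \<le> CARD('n)" and "k2 \<le> CARD('n)"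
    and "j permutes {1..CARD('m)}" and "\<zeta> permutes {1..CARD('n)}"
  shows "(simply_connected G' \<longrightarrow>
      ((\<exists>\<mu>. form_last_multiplier X G' s1 s2 k1 k2 j \<zeta> \<mu> \<and> (\<forall>x\<in>G'. \<mu> x \<noteq> 0)) \<longleftrightarrow>
       (\<exists>\<psi>1 \<psi>2 \<phi>1 \<phi>2. E_solution X G' s1 s2 k1 k2 j \<zeta> \<psi>1 \<psi>2 \<phi>1 \<phi>2 \<and>
          has_integrating_factor_1 (missing_vars CARD('m) CARD('n) s1 s2 k1 k2 j \<zeta>) G'
            (omega s1 s2 k1 k2 j \<zeta> \<psi>1 \<psi>2 \<phi>1 \<phi>2)))) \<and>
    (\<forall>\<psi>1 \<psi>2 \<phi>1 \<phi>2 g. E_solution X G' s1 s2 k1 k2 j \<zeta> \<psi>1 \<psi>2 \<phi>1 \<phi>2 \<and>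
        form_integral (missing_vars CARD('m) CARD('n) s1 s2 k1 k2 j \<zeta>) G'
          (omega s1 s2 k1 k2 j \<zeta> \<psi>1 \<psi>2 \<phi>1 \<phi>2) g \<longrightarrow>
        form_last_multiplier X G' s1 s2 k1 k2 j \<zeta> (\<lambda>x. exp (g x)))"
proof -
  have "open G'" "G' \<noteq> {}"
    using assms(2) by (auto simp: domain_in_def)
  interpret multiplier_setting X G' s1 s2 k1 k2 j \<zeta> "missing_vars CARD('m) CARD('n) s1 s2 k1 k2 j \<zeta>"
  proof
    show "R_differentiable_on (k1 + k2 + 1) G' (X \<xi> l)"
      if "\<xi> \<in> {1..CARD('n)}" "l \<in> {1..2 * CARD('m)}" for \<xi> l
      using assms(3,4) that by (blast intro: R_differentiable_on_subset)
  qed (use assms \<open>open G'\<close> in auto)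
  show ?thesis
  proof (intro conjI impI iffI allI)
    assume "simply_connected G'"
      and "\<exists>\<mu>. form_last_multiplier X G' s1 s2 k1 k2 j \<zeta> \<mu> \<and> (\<forall>x\<in>G'. \<mu> x \<noteq> 0)"
    then show "\<exists>\<psi>1 \<psi>2 \<phi>1 \<phi>2. E_solution X G' s1 s2 k1 k2 j \<zeta> \<psi>1 \<psi>2 \<phi>1 \<phi>2 \<and>
        has_integrating_factor_1 (missing_vars CARD('m) CARD('n) s1 s2 k1 k2 j \<zeta>) G' (\<omega> \<psi>1 \<psi>2 \<phi>1 \<phi>2)"
      using integrating_factor_from_multiplier by blast
  next
    assume "\<exists>\<psi>1 \<psi>2 \<phi>1 \<phi>2. E_solution X G' s1 s2 k1 k2 j \<zeta> \<psi>1 \<psi>2 \<phi>1 \<phi>2 \<and>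
        has_integrating_factor_1 (missing_vars CARD('m) CARD('n) s1 s2 k1 k2 j \<zeta>) G' (\<omega> \<psi>1 \<psi>2 \<phi>1 \<phi>2)"
    then obtain \<psi>1 \<psi>2 \<phi>1 \<phi>2 g where "E_solution X G' s1 s2 k1 k2 j \<zeta> \<psi>1 \<psi>2 \<phi>1 \<phi>2"
      "form_integral (missing_vars CARD('m) CARD('n) s1 s2 k1 k2 j \<zeta>) G' (\<omega> \<psi>1 \<psi>2 \<phi>1 \<phi>2) g"
      unfolding has_integrating_factor_1_def by blast
    then have "form_last_multiplier X G' s1 s2 k1 k2 j \<zeta> (\<lambda>x. exp (g x))"
      by (rule form_last_multiplier_exp_integral[OF \<open>G' \<noteq> {}\<close>])
    then show "\<exists>\<mu>. form_last_multiplier X G' s1 s2 k1 k2 j \<zeta> \<mu> \<and> (\<forall>x\<in>G'. \<mu> x \<noteq> 0)"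
      by (auto simp only: intro!: exI[of _ "\<lambda>x. exp (g x)"] exp_not_eq_zero)
  next
    fix \<psi>1 \<psi>2 \<phi>1 \<phi>2 g
    assume "E_solution X G' s1 s2 k1 k2 j \<zeta> \<psi>1 \<psi>2 \<phi>1 \<phi>2 \<and>
        form_integral (missing_vars CARD('m) CARD('n) s1 s2 k1 k2 j \<zeta>) G' (\<omega> \<psi>1 \<psi>2 \<phi>1 \<phi>2) g"
    then show "form_last_multiplier X G' s1 s2 k1 k2 j \<zeta> (\<lambda>x. exp (g x))"
      using form_last_multiplier_exp_integral[OF \<open>G' \<noteq> {}\<close>] by blast
  qed
qed

end
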